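(* Let $X$ be a uniformly convex and uniformly smooth Banach space and let $D\ni I$ be a subset of a dislocation group $D_0$ on $X$. Then every bounded sequence $(x_k)\subset X$ admits a Δ-profile decomposition relative to $D$. Moreover, if $\|x_k\|\le1$ for all $k$ and $\delta$ is the modulus of convexity of $X$, then the profiles satisfy $\|w^{(n)}\|\le2$ for all $n$ and $$\limsup_{k\to\infty}\|r_k\|+\sum_n\delta(\|w^{(n)}\|)\le1.$$
   Context: Δ-convergence: $x_k\rightharpoondown x$ if for every $y\in X$, $\limsup_k(\|x_k-x\|-\|x_k-y\|)\le0$. Operator convergence $g_k\rightharpoonup g$ means $g_kx\rightharpoonup gx$ weakly for every $x$; strong convergence means $g_kx\to gx$ in norm for every $x$. A group $D_0$ of bijective linear isometries of $X$ is a dislocation group if: $(\ast)$ whenever $(g_k)\subset D_0$ and $g_k\not\rightharpoonup0$, some subsequence has both $(g_{k_j})$ and $(g_{k_j}^{-1})$ strongly convergent; and $(\ast\ast)$ whenever $u_k\rightharpoondown0$, $w\in X$, $(g_k)\subset D_0$ and $g_k\rightharpoonup0$, then $u_k+g_kw\rightharpoondown0$. A sequence $(r_k)$ is $D$-Δ-convergent to $0$ if $g_k^{-1}r_k\rightharpoondown0$ for every sequence $(g_k)\subset D$. A bounded sequence $(u_k)$ admits a Δ-profile decomposition relative to $D$ if there exist $w^{(n)}\in X$ and sequences $(g_k^{(n)})_k\subset D$, $n\in\mathbb N$, with $g^{(1)}_k=I$, $(g_k^{(n)})^{-1}g_k^{(m)}\rightharpoonup0$ whenever $m\ne n$, and a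 sequence $(r_k)$ $D$-Δ-convergent to $0$, such that along a subsequence (renamed $(u_k)$) $u_k=\sum_{j=1}^\infty g_k^{(j)}w^{(j)}+r_k$, the series converging in $X$ unconditionally and uniformly in $k$. The modulus of convexity is $\delta(\epsilon)=\inf\{1-\|\tfrac{x+y}2\|:\|x\|=\|y\|=1,\|x-y\|=\epsilon\}$, $\epsilon\in[0,2]$.
   Formalization: The condition that (g_k^(n))^{-1} g_k^(m) tends weakly to 0 is required only when w^(m) and w^(n) are both nonzero (for all m≠n it fails for D={I}), and δ is set to 0 where its defining set is empty (dimension at most 1). *)

theory Defs
  imports "HOL-Analysis.Analysis" "HOL-Library.Liminf_Limsup"
begin

definition uniformly_convex :: "'a::real_normed_vector itself \<Rightarrow> bool" where
  "uniformly_convex _ \<longleftrightarrow>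
     (\<forall>e>0. \<exists>d>0. \<forall>x y::'a. norm x \<le> 1 \<longrightarrow> norm y \<le> 1 \<longrightarrow> norm (x - y) \<ge> e
        \<longrightarrow> norm ((x + y) /\<^sub>R 2) \<le> 1 - d)"

definition uniformly_smooth :: "'a::real_normed_vector itself \<Rightarrow> bool" where
  "uniformly_smooth _ \<longleftrightarrow>
     (\<forall>e>0. \<exists>t0>0. \<forall>t. 0 < t \<longrightarrow> t < t0 \<longrightarrow> (\<forall>x y::'a. norm x = 1 \<longrightarrow> norm y = 1 \<longrightarrow>
        (norm (x + t *\<^sub>R y) + norm (x - t *\<^sub>R y)) / 2 - 1 \<le> e * t))"

text \<open>Modulus of convexity; the infimum of the empty set (possible only in
  dimension \<le> 1) is taken to be 0.\<close>
definition modulus_convexity :: "'a::real_normed_vector itself \<Rightarrow> real \<Rightarrow> real" where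
  "modulus_convexity _ e =
     (let S = {1 - norm ((x + y) /\<^sub>R 2) | x y::'a. norm x = 1 \<and> norm y = 1 \<and> norm (x - y) = e}
      in if S = {} then 0 else Inf S)"

definition weak_conv :: "(nat \<Rightarrow> 'a::real_normed_vector) \<Rightarrow> 'a \<Rightarrow> bool" where
  "weak_conv u x \<longleftrightarrow> (\<forall>f::'a \<Rightarrow> real. bounded_linear f \<longrightarrow> (\<lambda>k. f (u k)) \<longlonglongrightarrow> f x)"

definition delta_conv :: "(nat \<Rightarrow> 'a::real_normed_vector) \<Rightarrow> 'a \<Rightarrow> bool" where
  "delta_conv u x \<longleftrightarrow>
     (\<forall>y. limsup (\<lambda>k. ereal (norm (u k - x) - norm (u k - y))) \<le> 0)"

definition op_weak_conv :: "(nat \<Rightarrow> 'a \<Rightarrow> 'a::real_normed_vector) \<Rightarrow> ('a \<Rightarrow> 'a) \<Rightarrow> bool" where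
  "op_weak_conv gs g \<longleftrightarrow> (\<forall>x. weak_conv (\<lambda>k. gs k x) (g x))"

definition op_strong_conv :: "(nat \<Rightarrow> 'a \<Rightarrow> 'a::real_normed_vector) \<Rightarrow> ('a \<Rightarrow> 'a) \<Rightarrow> bool" where
  "op_strong_conv gs g \<longleftrightarrow> (\<forall>x. (\<lambda>k. gs k x) \<longlonglongrightarrow> g x)"

definition bij_linear_isometry :: "('a::real_normed_vector \<Rightarrow> 'a) \<Rightarrow> bool" where
  "bij_linear_isometry g \<longleftrightarrow> linear g \<and> bij g \<and> (\<forall>x. norm (g x) = norm x)"

definition dislocation_group :: "('a::real_normed_vector \<Rightarrow> 'a) set \<Rightarrow> bool" where
  "dislocation_group D0 \<longleftrightarrow>
     (\<forall>g\<in>D0. bij_linear_isometry g) \<and> id \<in> D0 \<and>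
     (\<forall>g\<in>D0. \<forall>h\<in>D0. g \<circ> h \<in> D0) \<and> (\<forall>g\<in>D0. inv g \<in> D0) \<and>
     (\<forall>gs. range gs \<subseteq> D0 \<longrightarrow> \<not> op_weak_conv gs (\<lambda>_. 0) \<longrightarrow>
        (\<exists>s. strict_mono s \<and> (\<exists>g. op_strong_conv (\<lambda>j. gs (s j)) g)
                             \<and> (\<exists>h. op_strong_conv (\<lambda>j. inv (gs (s j))) h))) \<and>
     (\<forall>u w gs. delta_conv u 0 \<longrightarrow> range gs \<subseteq> D0 \<longrightarrow> op_weak_conv gs (\<lambda>_. 0) \<longrightarrow>
        delta_conv (\<lambda>k. u k + gs k w) 0)"

definition D_delta_null :: "('a::real_normed_vector \<Rightarrow> 'a) set \<Rightarrow> (nat \<Rightarrow> 'a) \<Rightarrow> bool" where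
  "D_delta_null D r \<longleftrightarrow> (\<forall>gs. range gs \<subseteq> D \<longrightarrow> delta_conv (\<lambda>k. inv (gs k) (r k)) 0)"

definition unif_uncond_sum :: "(nat \<Rightarrow> nat \<Rightarrow> 'a::real_normed_vector) \<Rightarrow> (nat \<Rightarrow> 'a) \<Rightarrow> bool" where
  "unif_uncond_sum f S \<longleftrightarrow>
     (\<forall>e>0. \<exists>F0. finite F0 \<and> (\<forall>F. finite F \<longrightarrow> F0 \<subseteq> F \<longrightarrow>
        (\<forall>k. norm ((\<Sum>j\<in>F. f j k) - S k) < e)))"

text \<open>Delta-profile decomposition of u relative to D along the subsequence s,
  with profiles w n, dislocations g n k (the n-th sequence, k-th term; index 0 plays
  the role of the paper's index 1) and remainder r (indexed along the subsequence).\<close>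
definition delta_profile_decomp ::
  "('a::real_normed_vector \<Rightarrow> 'a) set \<Rightarrow> (nat \<Rightarrow> 'a) \<Rightarrow> (nat \<Rightarrow> nat)
     \<Rightarrow> (nat \<Rightarrow> 'a) \<Rightarrow> (nat \<Rightarrow> nat \<Rightarrow> 'a \<Rightarrow> 'a) \<Rightarrow> (nat \<Rightarrow> 'a) \<Rightarrow> bool" where
  "delta_profile_decomp D u s w g r \<longleftrightarrow>
     strict_mono s \<and>
     (\<forall>n k. g n k \<in> D) \<and> (\<forall>k. g 0 k = id) \<and>
     (\<forall>m n. m \<noteq> n \<longrightarrow> w m \<noteq> 0 \<longrightarrow> w n \<noteq> 0 \<longrightarrow>
        op_weak_conv (\<lambda>k. inv (g n k) \<circ> g m k) (\<lambda>_. 0)) \<and>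
     D_delta_null D r \<and>
     (\<exists>S. unif_uncond_sum (\<lambda>j k. g j k (w j)) S \<and> (\<forall>k. u (s k) = S k + r k))"

definition has_delta_profile_decomp :: "('a::real_normed_vector \<Rightarrow> 'a) set \<Rightarrow> (nat \<Rightarrow> 'a) \<Rightarrow> bool" where
  "has_delta_profile_decomp D u \<longleftrightarrow> (\<exists>s w g r. delta_profile_decomp D u s w g r)"

end

theory Submission
  imports Defs
begin

text \<open>Profiles are extracted greedily: at every stage subtract the moved profile \<open>g k w\<close> where the
  norm of \<open>w\<close> is at least half of what is available, and pass to a subsequence. Since removing a
  \<Delta>-limit does not increase the norm asymptotically, neither does passing to the midpoint between
  the old and the new remainder, so uniform convexity makes the asymptotic norm of the remainder
  drop by the modulus of convexity of the profile; hence the profiles tend to zero. The same midpoint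
  comparison applied to a finite block of profiles bounds the norm of its sum by the decrease of the
  asymptotic norms across the block, which gives unconditional convergence. Uniform convexity also
  makes \<Delta>-limits stable under small perturbations, so that smallness of the profiles of the
  partial remainders carries over to \<Delta>-nullity of the final remainder.\<close>

section \<open>\<Delta>-convergence and uniform convexity\<close>

text \<open>No Pythagorean identity is available to add up the energies of profiles. Its substitute:
  putting decoupled terms \<open>c j *\<^sub>R g j k (w j)\<close> back into a remainder never
  lowers the asymptotic norm, whatever the coefficients; coefficients 1/2 produce the midpoints. The
  sharp constant 1 in the energy bound needs more than uniform convexity, because
  \<open>modulus_convexity\<close> sees only pairs on the unit sphere at an exact distance, whereas
  consecutive remainders lie inside the ball with different norms, and rescaling them would change
  the distance. Uniformity in \<open>k\<close> is a separate obstacle: each estimate on a block of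
  profiles holds only eventually, with a threshold depending on the block, so the dislocations have
  to be altered at finitely many \<open>k\<close> for each index. Maximality holds up to a factor 2
  because a supremum over \<Delta>-limits need not be attained, and only from index 1 on because the
  dislocations of index 0 are prescribed to be the identity.\<close>

lemma delta_conv_iff:
  "delta_conv u x \<longleftrightarrow>
    (\<forall>y. \<forall>e>0. \<forall>\<^sub>F k in sequentially. norm (u k - x) \<le> norm (u k - y) + e)"
proof -
  have "limsup (\<lambda>k. ereal (norm (u k - x) - norm (u k - y))) \<le> 0 \<longleftrightarrow>
      (\<forall>e>0. \<forall>\<^sub>F k in sequentially. norm (u k - x) \<le> norm (u k - y) + e)" (is "?L \<longleftrightarrow> ?R") for y
  proof
    assume ?L
    show ?R
    proof (intro allI impI)
      fix e :: real assume "e > 0"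
      then have "\<forall>\<^sub>F k in sequentially. ereal (norm (u k - x) - norm (u k - y)) < ereal e"
        using \<open>?L\<close> unfolding Limsup_le_iff by (metis ereal_less(2))
      then show "\<forall>\<^sub>F k in sequentially. norm (u k - x) \<le> norm (u k - y) + e"
        by (rule eventually_mono) auto
    qed
  next
    assume R: ?R
    show ?L
      unfolding Limsup_le_iff
    proof (intro allI impI)
      fix z :: ereal assume "0 < z"
      then obtain e where e: "0 < ereal e" "ereal e < z"
        using ereal_dense2 by blast
      then have "\<forall>\<^sub>F k in sequentially. norm (u k - x) \<le> norm (u k - y) + e"
        using R by (simp add: zero_ereal_def)
      then show "\<forall>\<^sub>F k in sequentially. ereal (norm (u k - x) - norm (u k - y)) < z"
      proof (rule eventually_mono)
        fix k assume "norm (u k - x) \<le> norm (u k - y) + e"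
        then have "ereal (norm (u k - x) - norm (u k - y)) \<le> ereal e" by simp
        then show "ereal (norm (u k - x) - norm (u k - y)) < z" using e(2) by (rule le_less_trans)
      qed
    qed
  qed
  then show ?thesis unfolding delta_conv_def by simp
qed

lemma delta_convD:
  "delta_conv u x \<Longrightarrow> e > 0 \<Longrightarrow> \<forall>\<^sub>F k in sequentially. norm (u k - x) \<le> norm (u k - y) + e"
  unfolding delta_conv_iff by blast

lemma delta_conv_subseq:
  assumes "delta_conv u x" "strict_mono s"
  shows "delta_conv (\<lambda>k. u (s k)) x"
  unfolding delta_conv_iff
proof (intro allI impI)
  fix y and e :: real assume "e > 0"
  from delta_convD[OF assms(1) this]
  show "\<forall>\<^sub>F k in sequentially. norm (u (s k) - x) \<le> norm (u (s k) - y) + e"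
    by (rule eventually_subseq[OF assms(2)])
qed

lemma delta_conv_shift:
  assumes "delta_conv (\<lambda>k. u (n + k)) x"
  shows "delta_conv u x"
  unfolding delta_conv_iff
proof (intro allI impI)
  fix y and e :: real assume "e > 0"
  from delta_convD[OF assms this, of y]
  have "\<forall>\<^sub>F k in sequentially. norm (u (k + n) - x) \<le> norm (u (k + n) - y) + e"
    by (simp add: add.commute)
  then show "\<forall>\<^sub>F k in sequentially. norm (u k - x) \<le> norm (u k - y) + e"
    using eventually_sequentially_seg[where P="\<lambda>k. norm (u k - x) \<le> norm (u k - y) + e" and k=n] by simp
qed

lemma delta_conv_diff_const:
  assumes "delta_conv u x"
  shows "delta_conv (\<lambda>k. u k - x) 0"
  unfolding delta_conv_iff
proof (intro allI impI)
  fix y and e :: real assume "e > 0"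
  from delta_convD[OF assms this, of "x + y"]
  show "\<forall>\<^sub>F k in sequentially. norm (u k - x - 0) \<le> norm (u k - x - y) + e"
    by (simp add: diff_diff_eq)
qed

lemma norm_midpoint_le:
  fixes a b :: "'a::real_normed_vector"
  assumes "norm a \<le> R" "norm b \<le> R"
  shows "norm ((a + b) /\<^sub>R 2) \<le> R"
  using norm_triangle_ineq[of a b] assms by simp

text \<open>Divide by \<open>R\<close>. Since \<open>e \<le> norm (a - b) \<le> 2 * R\<close>, the
  radius is at least \<open>e / 2\<close>, so the scaled gain \<open>R * d\<close> is at least
  \<open>e / 2 * d\<close>; and the scaled distance is at least \<open>e / M'\<close>. The gain is
  uniform in \<open>R\<close>, which matters because radii later vary with \<open>k\<close>.\<close>

lemma uniformly_convex_scaled: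
  assumes uc: "uniformly_convex TYPE('a::real_normed_vector)" and e: "e > 0"
  shows "\<exists>\<eta>>0. \<forall>(a::'a) b R. norm a \<le> R \<longrightarrow> norm b \<le> R \<longrightarrow> R \<le> M \<longrightarrow> e \<le> norm (a - b) \<longrightarrow>
       norm ((a + b) /\<^sub>R 2) \<le> R - \<eta>"
proof -
  define M' where "M' = max M 1"
  have M': "M' > 0" "M \<le> M'" by (auto simp: M'_def)
  have "e / M' > 0" using e M' by simp
  then obtain d where d: "d > 0" and D: "\<And>x y::'a. norm x \<le> 1 \<Longrightarrow> norm y \<le> 1 \<Longrightarrow>
      norm (x - y) \<ge> e / M' \<Longrightarrow> norm ((x + y) /\<^sub>R 2) \<le> 1 - d"
    using uc[unfolded uniformly_convex_def, rule_format, of "e / M'"] by blast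
  show ?thesis
  proof (intro exI[of _ "e / 2 * d"] conjI allI impI)
    show "e / 2 * d > 0" using e d by simp
    fix a b :: 'a and R
    assume a: "norm a \<le> R" and b: "norm b \<le> R" and R: "R \<le> M" and ab: "e \<le> norm (a - b)"
    have R2: "e / 2 \<le> R" using norm_triangle_ineq4[of a b] a b ab by simp
    then have R0: "R > 0" using e by simp
    have "norm (a /\<^sub>R R - b /\<^sub>R R) = norm (a - b) / R"
      using R0 by (simp add: scaleR_diff_right[symmetric] inverse_eq_divide del: scaleR_diff_right)
    moreover have "e / M' \<le> norm (a - b) / R"
      using R0 R M' ab e by (intro frac_le) auto
    ultimately have "norm ((a /\<^sub>R R + b /\<^sub>R R) /\<^sub>R 2) \<le> 1 - d"
      using a b R0 by (intro D) (simp_all add: inverse_eq_divide)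
    moreover have "(a /\<^sub>R R + b /\<^sub>R R) /\<^sub>R 2 = ((a + b) /\<^sub>R 2) /\<^sub>R R"
      by (simp add: scaleR_add_right algebra_simps)
    moreover have "norm (z /\<^sub>R R) = norm z / R" for z :: 'a
      using R0 by (simp add: field_simps)
    ultimately have "norm ((a + b) /\<^sub>R 2) / R \<le> 1 - d" by metis
    then have "norm ((a + b) /\<^sub>R 2) \<le> (1 - d) * R"
      using R0 by (simp only: pos_divide_le_eq)
    also have "(1 - d) * R = R - R * d" by (simp add: algebra_simps)
    finally have "norm ((a + b) /\<^sub>R 2) \<le> R - R * d" .
    moreover have "e / 2 * d \<le> R * d" using R2 d by simp
    ultimately show "norm ((a + b) /\<^sub>R 2) \<le> R - e / 2 * d" by linarith
  qed
qed

section \<open>Diagonal arguments for nested subsequences\<close>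

text \<open>From index \<open>n\<close> on, the diagonal factors through \<open>S n\<close>. The
  conclusion speaks of every further subsequence \<open>t\<close> of the diagonal because maximality
  and regularity statements quantify over all of these.\<close>

lemma diagonal_subsequence:
  fixes S r :: "nat \<Rightarrow> nat \<Rightarrow> nat"
  assumes r: "\<And>n. strict_mono (r n)" and S0: "strict_mono (S 0)"
    and S: "\<And>n. S (Suc n) = S n \<circ> r n"
  shows "\<exists>d :: nat \<Rightarrow> nat. strict_mono d \<and>
    (\<forall>n t. strict_mono t \<longrightarrow> (\<exists>t'. strict_mono t' \<and> (\<forall>i. d (t (n + i)) = S n (t' i))))"
proof -
  define d where "d i = S i i" for i
  have *: "\<exists>t. strict_mono t \<and> (\<forall>i. d (n + i) = S n (t i))" for n
  proof -
    \<comment> \<open>\<open>q i\<close> composes the refinements \<open>r n\<close>, ...,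
      \<open>r (n + i - 1)\<close>, so that \<open>S (n + i) = S n \<circ> q i\<close>.\<close>
    define q where "q = rec_nat (id::nat \<Rightarrow> nat) (\<lambda>i f. f \<circ> r (n + i))"
    have q0: "q 0 = id" and qS: "\<And>i. q (Suc i) = q i \<circ> r (n + i)"
      by (simp_all add: q_def)
    have sq: "strict_mono (q i)" for i
    proof (induction i)
      case 0
      show ?case by (simp add: q0 strict_mono_def)
    next
      case (Suc i)
      show ?case unfolding qS by (rule strict_mono_o[OF Suc r])
    qed
    have Sq: "S (n + i) = S n \<circ> q i" for i
      by (induction i) (auto simp: q0 qS S comp_assoc)
    define t where "t i = q i (n + i)" for i
    have "strict_mono t"
      unfolding strict_mono_Suc_iff
    proof
      fix i
      have "n + i < r (n + i) (n + Suc i)"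
        using seq_suble[OF r[of "n + i"], of "n + Suc i"] by simp
      then show "t i < t (Suc i)"
        unfolding t_def qS using strict_monoD[OF sq] by simp
    qed
    moreover have "d (n + i) = S n (t i)" for i
      by (simp add: d_def Sq t_def)
    ultimately show ?thesis by blast
  qed
  show ?thesis
  proof (rule exI[of _ d], intro conjI allI impI)
    obtain t where "strict_mono t" "\<And>i. d (0 + i) = S 0 (t i)" using *[of 0] by blast
    then have "d = S 0 \<circ> t" by auto
    then show "strict_mono d" using \<open>strict_mono t\<close> S0 by (simp add: strict_mono_o)
    fix n and t :: "nat \<Rightarrow> nat" assume t: "strict_mono t"
    obtain t' where t': "strict_mono t'" "\<And>i. d (n + i) = S n (t' i)" using *[of n] by blast
    have ge: "n + i \<le> t (n + i)" for i using seq_suble[OF t] .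
    have "strict_mono (\<lambda>i. t' (t (n + i) - n))"
    proof (rule strict_monoI)
      fix i j :: nat assume "i < j"
      then have "t (n + i) < t (n + j)" using t by (simp add: strict_monoD)
      then have "t (n + i) - n < t (n + j) - n" using ge[of i] by simp
      then show "t' (t (n + i) - n) < t' (t (n + j) - n)" using t'(1) by (simp add: strict_monoD)
    qed
    moreover have "d (t (n + i)) = S n (t' (t (n + i) - n))" for i
      using t'(2)[of "t (n + i) - n"] ge[of i] by simp
    ultimately show "\<exists>t'. strict_mono t' \<and> (\<forall>i. d (t (n + i)) = S n (t' i))" by blast
  qed
qed

text \<open>Stage \<open>n\<close> refines until no further subsequence lowers \<open>\<phi>\<close>
  by more than \<open>1 / Suc n\<close>. The diagonal inherits all these bounds, since by
  \<open>shift\<close> and \<open>mono\<close> dropping an initial segment leaves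
  \<open>\<phi>\<close> unchanged.\<close>

lemma subsequence_exhaustion:
  fixes \<phi> :: "(nat \<Rightarrow> nat) \<Rightarrow> real"
  assumes mono: "\<And>s t. strict_mono s \<Longrightarrow> strict_mono t \<Longrightarrow> \<phi> (s \<circ> t) \<le> \<phi> s"
    and shift: "\<And>s n. strict_mono s \<Longrightarrow> \<phi> s \<le> \<phi> (\<lambda>i. s (n + i))"
    and nonneg: "\<And>s. strict_mono s \<Longrightarrow> 0 \<le> \<phi> s"
  obtains s where "strict_mono s" "\<And>t. strict_mono t \<Longrightarrow> \<phi> (s \<circ> t) = \<phi> s"
proof -
  have step: "\<exists>t. strict_mono t \<and> (\<forall>t'. strict_mono t' \<longrightarrow> \<phi> (s \<circ> t) \<le> \<phi> (s \<circ> t \<circ> t') + e)"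
    if s: "strict_mono s" and e: "e > 0" for s :: "nat \<Rightarrow> nat" and e :: real
  proof -
    define A where "A = {\<phi> (s \<circ> t) |t. strict_mono t}"
    have ne: "A \<noteq> {}" unfolding A_def using strict_mono_id by blast
    have bdd: "bdd_below A"
      unfolding A_def by (intro bdd_belowI[of _ 0]) (auto intro!: nonneg strict_mono_o s)
    obtain t where t: "strict_mono t" "\<phi> (s \<circ> t) < Inf A + e"
      using cInf_lessD[OF ne, of "Inf A + e"] e unfolding A_def by auto
    have "\<phi> (s \<circ> t) \<le> \<phi> (s \<circ> t \<circ> t') + e" if "strict_mono t'" for t'
    proof -
      have "\<phi> (s \<circ> (t \<circ> t')) \<in> A" unfolding A_def using t(1) that strict_mono_o by blast
      then have "Inf A \<le> \<phi> (s \<circ> (t \<circ> t'))" using bdd by (rule cInf_lower)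
      then show ?thesis using t(2) by (simp add: comp_assoc)
    qed
    with t(1) show ?thesis by blast
  qed
  have "\<exists>S. \<forall>n. strict_mono (S n) \<and> (\<exists>r. strict_mono r \<and> S (Suc n) = S n \<circ> r \<and>
      (\<forall>t'. strict_mono t' \<longrightarrow> \<phi> (S (Suc n)) \<le> \<phi> (S (Suc n) \<circ> t') + 1 / real (Suc n)))"
    (is "\<exists>S. \<forall>n. _ \<and> ?Q n (S n) (S (Suc n))")
  proof (rule dependent_nat_choice)
    show "\<exists>s::nat \<Rightarrow> nat. strict_mono s" using strict_mono_id by blast
    fix s :: "nat \<Rightarrow> nat" and n assume s: "strict_mono s"
    obtain t where t: "strict_mono t"
      "\<forall>t'. strict_mono t' \<longrightarrow> \<phi> (s \<circ> t) \<le> \<phi> (s \<circ> t \<circ> t') + 1 / real (Suc n)"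
      using step[OF s, of "1 / real (Suc n)"] by (meson of_nat_0_less_iff zero_less_Suc zero_less_divide_1_iff)
    show "\<exists>y. strict_mono y \<and> ?Q n s y"
      by (rule exI[of _ "s \<circ> t"], rule conjI, rule strict_mono_o[OF s t(1)],
          rule exI[of _ t], intro conjI t refl)
  qed
  then obtain S where S: "\<forall>n. strict_mono (S n) \<and> ?Q n (S n) (S (Suc n))" by (rule exE)
  have S1: "strict_mono (S n)" for n using spec[OF S, of n] by (rule conjunct1)
  have "?Q n (S n) (S (Suc n))" for n using spec[OF S, of n] by (rule conjunct2)
  then have "\<forall>n. ?Q n (S n) (S (Suc n))" by (rule allI)
  then obtain r where r1: "\<And>n. strict_mono (r n)" and r2: "\<And>n. S (Suc n) = S n \<circ> r n"
    and Q: "\<And>n t'. strict_mono t' \<Longrightarrow> \<phi> (S (Suc n)) \<le> \<phi> (S (Suc n) \<circ> t') + 1 / real (Suc n)"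
    by metis
  obtain d :: "nat \<Rightarrow> nat" where d: "strict_mono d" and dd:
    "\<And>n t. strict_mono t \<Longrightarrow> \<exists>t'. strict_mono t' \<and> (\<forall>i. d (t (n + i)) = S n (t' i))"
    using diagonal_subsequence[of r S, OF r1 S1 r2] by blast
  show ?thesis
  proof
    show "strict_mono d" by (rule d)
    fix t :: "nat \<Rightarrow> nat" assume t: "strict_mono t"
    have "\<phi> d \<le> \<phi> (d \<circ> t) + 1 / real (Suc n)" for n
    proof -
      obtain t1 where t1: "strict_mono t1" "\<And>i. d (id (Suc n + i)) = S (Suc n) (t1 i)"
        using dd[OF strict_mono_id, of "Suc n"] by blast
      obtain t2 where t2: "strict_mono t2" "\<And>i. d (t (Suc n + i)) = S (Suc n) (t2 i)"
        using dd[OF t, of "Suc n"] by blast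
      have "\<phi> d \<le> \<phi> (\<lambda>i. d (Suc n + i))" using d by (rule shift)
      also have "(\<lambda>i. d (Suc n + i)) = S (Suc n) \<circ> t1" using t1(2) by (auto simp: fun_eq_iff)
      also have "\<phi> \<dots> \<le> \<phi> (S (Suc n))" using S1 t1(1) by (rule mono)
      also have "\<dots> \<le> \<phi> (S (Suc n) \<circ> t2) + 1 / real (Suc n)" using t2(1) by (rule Q)
      also have "S (Suc n) \<circ> t2 = (d \<circ> t) \<circ> (\<lambda>i. Suc n + i)" using t2(2) by (auto simp: fun_eq_iff)
      also have "\<phi> \<dots> \<le> \<phi> (d \<circ> t)"
        using d t by (intro mono) (auto simp: strict_mono_o strict_mono_def)
      finally show ?thesis by simp
    qed
    moreover have "(\<lambda>n. \<phi> (d \<circ> t) + 1 / real (Suc n)) \<longlonglongrightarrow> \<phi> (d \<circ> t) + 0"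
      using LIMSEQ_inverse_real_of_nat_add[of "\<phi> (d \<circ> t)"] by (simp add: divide_inverse)
    ultimately have "\<phi> d \<le> \<phi> (d \<circ> t)" by (intro LIMSEQ_le_const) auto
    then show "\<phi> (d \<circ> t) = \<phi> d" using mono[OF d t] by simp
  qed
qed

lemma not_eventually_subseq:
  assumes "\<not> (\<forall>\<^sub>F k in sequentially. P k)"
  shows "\<exists>t :: nat \<Rightarrow> nat. strict_mono t \<and> (\<forall>k. \<not> P (t k))"
proof -
  have "infinite {k. \<not> P k}"
    using assms by (simp add: cofinite_eq_sequentially[symmetric] eventually_cofinite)
  from infinite_enumerate[OF this] show ?thesis by auto
qed

section \<open>Stability, uniqueness and existence of \<Delta>-limits\<close>

lemma midpoint_diff:
  fixes a p q :: "'a::real_vector"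
  shows "((a - p) + (a - q)) /\<^sub>R 2 = a - (p + q) /\<^sub>R 2"
proof -
  have "(a - p) + (a - q) = 2 *\<^sub>R a - (p + q)" by (simp add: scaleR_2)
  then show ?thesis by (simp only: scaleR_diff_right) simp
qed

text \<open>Testing the \<Delta>-limit against the competitor 0 gives \<open>norm (u k - x)\<close>
  at most \<open>norm (u k)\<close> asymptotically; the factor 2 is the triangle inequality.\<close>

lemma delta_limit_norm_le:
  assumes "delta_conv u x" "\<forall>\<^sub>F k in sequentially. norm (u k) \<le> M"
  shows "norm x \<le> 2 * M"
proof (rule field_le_epsilon)
  fix e :: real assume "e > 0"
  have "\<forall>\<^sub>F k in sequentially. norm (u k - x) \<le> norm (u k - 0) + e \<and> norm (u k) \<le> M"
    using delta_convD[OF assms(1) \<open>e > 0\<close>, of 0] assms(2) by eventually_elim simp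
  then obtain k where "norm (u k - x) \<le> norm (u k) + e" "norm (u k) \<le> M"
    by (auto dest: eventually_happens)
  then show "norm x \<le> 2 * M + e"
    using norm_triangle_ineq4[of "u k" "u k - x"] by simp
qed

text \<open>\<open>p\<close> is nearly an optimal center for \<open>a\<close>, and so is
  \<open>q\<close>, being optimal for the nearby \<open>b\<close>. If \<open>p\<close> and
  \<open>q\<close> were \<open>e\<close> apart, uniform convexity would make their midpoint
  \<open>m\<close> better than \<open>p\<close> by a fixed amount, against \<Delta>-convergence of
  \<open>a\<close> to \<open>p\<close>.\<close>

lemma delta_limit_stable:
  assumes uc: "uniformly_convex TYPE('a::real_normed_vector)" and e: "e > 0"
  shows "\<exists>\<eta>>0. \<forall>a b (p::'a) q. delta_conv a p \<longrightarrow> delta_conv b q \<longrightarrow>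
       (\<forall>\<^sub>F k in sequentially. norm (a k - b k) \<le> \<eta>) \<longrightarrow>
       (\<forall>\<^sub>F k in sequentially. norm (a k) \<le> M) \<longrightarrow> norm (p - q) < e"
proof -
  obtain \<eta>1 where \<eta>1: "\<eta>1 > 0" and mid:
    "\<And>(a::'a) b R. norm a \<le> R \<Longrightarrow> norm b \<le> R \<Longrightarrow> R \<le> M + 6 \<Longrightarrow> e \<le> norm (a - b) \<Longrightarrow>
       norm ((a + b) /\<^sub>R 2) \<le> R - \<eta>1"
    using uniformly_convex_scaled[OF uc e, of "M + 6"] by blast
  define \<eta> where "\<eta> = min 1 (\<eta>1 / 4)"
  have \<eta>: "0 < \<eta>" "\<eta> \<le> 1" "3 * \<eta> < \<eta>1" using \<eta>1 by (auto simp: \<eta>_def)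
  show ?thesis
  proof (intro exI[of _ \<eta>] conjI allI impI)
    show "\<eta> > 0" by (rule \<eta>)
    fix a b :: "nat \<Rightarrow> 'a" and p q
    assume a: "delta_conv a p" and b: "delta_conv b q"
      and ab: "\<forall>\<^sub>F k in sequentially. norm (a k - b k) \<le> \<eta>"
      and M: "\<forall>\<^sub>F k in sequentially. norm (a k) \<le> M"
    define m where "m = (p + q) /\<^sub>R 2"
    have "\<forall>\<^sub>F k in sequentially. norm (a k - p) \<le> norm (a k - 0) + \<eta> \<and>
        norm (a k - p) \<le> norm (a k - m) + \<eta> \<and>
        norm (b k - q) \<le> norm (b k - 0) + \<eta> \<and> norm (b k - q) \<le> norm (b k - m) + \<eta> \<and>
        norm (a k - b k) \<le> \<eta> \<and> norm (a k) \<le> M"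
      by (intro eventually_conj delta_convD[OF a \<eta>(1)] delta_convD[OF b \<eta>(1)] ab M)
    then obtain k where k: "norm (a k - p) \<le> norm (a k) + \<eta>"
        "norm (a k - p) \<le> norm (a k - m) + \<eta>"
        "norm (b k - q) \<le> norm (b k) + \<eta>" "norm (b k - q) \<le> norm (b k - m) + \<eta>"
        "norm (a k - b k) \<le> \<eta>" "norm (a k) \<le> M"
      by (auto dest: eventually_happens)
    \<comment> \<open>\<open>3 * \<eta>\<close> collects the passage from \<open>a\<close> to
      \<open>b\<close>, the near-optimality of \<open>q\<close> for \<open>b\<close> against
      \<open>m\<close>, and the passage back from \<open>b\<close> to \<open>a\<close>. As
      \<open>\<eta> \<le> 1\<close>, this also explains the bounds \<open>M + 3\<close> and
      \<open>M + 6\<close>.\<close>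
    define R where "R = norm (a k - m) + 3 * \<eta>"
    have aq: "norm (a k - q) \<le> norm (a k - b k) + norm (b k - q)"
      using norm_triangle_ineq[of "a k - b k" "b k - q"] by simp
    have bm: "norm (b k - m) \<le> norm (a k - b k) + norm (a k - m)"
      using norm_triangle_ineq[of "b k - a k" "a k - m"] by (simp add: norm_minus_commute)
    have bk: "norm (b k) \<le> norm (a k - b k) + norm (a k)"
      using norm_triangle_ineq[of "b k - a k" "a k"] by (simp add: norm_minus_commute)
    have mid_eq: "((a k - p) + (a k - q)) /\<^sub>R 2 = a k - m"
      unfolding m_def by (rule midpoint_diff)
    have "norm (a k - m) \<le> M + 3"
      using norm_midpoint_le[of "a k - p" "M + 3" "a k - q"] k aq bk \<eta>
      unfolding mid_eq by linarith
    then have RM: "R \<le> M + 6" using \<eta> unfolding R_def by simp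
    have "norm (a k - p) \<le> R" "norm (a k - q) \<le> R"
      unfolding R_def using k aq bm \<eta> by linarith+
    from mid[OF this RM] have "e \<le> norm (p - q) \<Longrightarrow> norm (a k - m) \<le> R - \<eta>1"
      unfolding mid_eq by (simp add: norm_minus_commute)
    then show "norm (p - q) < e"
      using \<eta>(3) unfolding R_def by (cases "e \<le> norm (p - q)") auto
  qed
qed

lemma delta_conv_unique:
  assumes uc: "uniformly_convex TYPE('a::real_normed_vector)"
    and "delta_conv u (p::'a)" "delta_conv u q" "bounded (range u)"
  shows "p = q"
proof -
  obtain M where M: "\<And>k. norm (u k) \<le> M" using assms(4) unfolding bounded_iff by auto
  have "norm (p - q) < e" if e: "e > 0" for e
  proof -
    obtain \<eta> where "\<eta> > 0" and \<eta>: "\<And>a b (p::'a) q. delta_conv a p \<Longrightarrow> delta_conv b q \<Longrightarrow>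
       \<forall>\<^sub>F k in sequentially. norm (a k - b k) \<le> \<eta> \<Longrightarrow>
       \<forall>\<^sub>F k in sequentially. norm (a k) \<le> M \<Longrightarrow> norm (p - q) < e"
      using delta_limit_stable[OF uc e, of M] by blast
    show ?thesis using \<eta>[OF assms(2,3)] \<open>\<eta> > 0\<close> M by simp
  qed
  from this[of "norm (p - q)"] show ?thesis by auto
qed

text \<open>A sequence all of whose subsequences have the same asymptotic radius \<Delta>-converges to
  its asymptotic center.\<close>
lemma delta_compact:
  assumes uc: "uniformly_convex TYPE('a::banach)" and bdd: "bounded (range (u :: nat \<Rightarrow> 'a))"
  shows "\<exists>s x. strict_mono s \<and> delta_conv (\<lambda>k. u (s k)) x"
proof -
  obtain M where M: "\<And>k. norm (u k) \<le> M" using bdd unfolding bounded_iff by auto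
  \<comment> \<open>\<open>Inf (A s)\<close> is the asymptotic radius of the subsequence: the
    infimum of radii of balls that eventually contain it.\<close>
  define A where "A s = {c. 0 \<le> c \<and> (\<exists>y. \<forall>\<^sub>F k in sequentially. norm (u (s k) - y) \<le> c)}"
    for s :: "nat \<Rightarrow> nat"
  have bA: "bdd_below (A s)" for s unfolding A_def by (rule bdd_belowI[of _ 0]) simp
  have nA: "A s \<noteq> {}" for s
  proof -
    have "M \<in> A s" using M order_trans[OF norm_ge_zero M]
      unfolding A_def by (auto intro!: exI[of _ 0])
    then show ?thesis by blast
  qed
  obtain s where s: "strict_mono s"
    and reg: "\<And>t. strict_mono t \<Longrightarrow> Inf (A (s \<circ> t)) = Inf (A s)"
  proof (rule subsequence_exhaustion[of "\<lambda>s. Inf (A s)"])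
    fix s t :: "nat \<Rightarrow> nat" assume "strict_mono t"
    then have "A s \<subseteq> A (s \<circ> t)"
      unfolding A_def by (auto intro: eventually_subseq)
    then show "Inf (A (s \<circ> t)) \<le> Inf (A s)" using nA bA by (intro cInf_superset_mono)
  next
    fix s :: "nat \<Rightarrow> nat" and n
    have "(\<forall>\<^sub>F k in sequentially. norm (u (s (n + k)) - y) \<le> c) \<longleftrightarrow>
        (\<forall>\<^sub>F k in sequentially. norm (u (s k) - y) \<le> c)" for y c
      using eventually_sequentially_seg[of "\<lambda>k. norm (u (s k) - y) \<le> c" n]
      by (simp add: add.commute)
    then have "A (\<lambda>i. s (n + i)) = A s" unfolding A_def by simp
    then show "Inf (A s) \<le> Inf (A (\<lambda>i. s (n + i)))" by simp
  next
    fix s show "0 \<le> Inf (A s)" using nA by (intro cInf_greatest) (auto simp: A_def)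
  qed blast
  define \<rho> where "\<rho> = Inf (A s)"
  have lower: "\<rho> \<le> c" if t: "strict_mono t" and ev: "\<forall>\<^sub>F k in sequentially. norm (u (s (t k)) - y) \<le> c" for t y c
  proof -
    obtain k where "norm (u (s (t k)) - y) \<le> c" using eventually_happens[OF ev] by auto
    then have "0 \<le> c" using norm_ge_zero order_trans by blast
    then have "c \<in> A (s \<circ> t)" using ev unfolding A_def by auto
    then show ?thesis using cInf_lower[OF _ bA] reg[OF t] unfolding \<rho>_def by metis
  qed
  have "\<exists>y. \<forall>\<^sub>F k in sequentially. norm (u (s k) - y) \<le> \<rho> + 1 / real (Suc n)" for n
  proof -
    obtain c where "c \<in> A s" and c: "c < \<rho> + 1 / real (Suc n)"
      using cInf_lessD[OF nA, of s "\<rho> + 1 / real (Suc n)"] unfolding \<rho>_def by auto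
    then obtain y where "\<forall>\<^sub>F k in sequentially. norm (u (s k) - y) \<le> c" unfolding A_def by auto
    then have "\<forall>\<^sub>F k in sequentially. norm (u (s k) - y) \<le> \<rho> + 1 / real (Suc n)"
      by (rule eventually_mono) (use c in linarith)
    then show ?thesis by (rule exI)
  qed
  then obtain y where y: "\<And>n. \<forall>\<^sub>F k in sequentially. norm (u (s k) - y n) \<le> \<rho> + 1 / real (Suc n)"
    by metis
  \<comment> \<open>Two far apart approximate centers would have a midpoint around which the
    sequence eventually has radius below \<open>\<rho>\<close>.\<close>
  have "Cauchy y"
  proof (rule metric_CauchyI)
    fix e :: real assume "e > 0"
    obtain \<eta> where \<eta>: "\<eta> > 0" and mid:
      "\<And>(a::'a) b R. norm a \<le> R \<Longrightarrow> norm b \<le> R \<Longrightarrow> R \<le> \<rho> + 1 \<Longrightarrow> e \<le> norm (a - b) \<Longrightarrow>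
        norm ((a + b) /\<^sub>R 2) \<le> R - \<eta>"
      using uniformly_convex_scaled[OF uc \<open>e > 0\<close>, of "\<rho> + 1"] by blast
    obtain N where N: "1 / real (Suc N) < \<eta>"
      using \<eta> nat_approx_posE by blast
    have "dist (y m) (y n) < e" if mn: "m \<ge> N" "n \<ge> N" for m n
    proof (rule ccontr)
      assume "\<not> dist (y m) (y n) < e"
      then have far: "e \<le> norm (y m - y n)" by (simp add: dist_norm)
      have le: "1 / real (Suc m) \<le> 1 / real (Suc N)" "1 / real (Suc n) \<le> 1 / real (Suc N)"
        using mn by (auto simp: frac_le)
      have "\<forall>\<^sub>F k in sequentially. norm (u (s (id k)) - (y m + y n) /\<^sub>R 2) \<le> \<rho> + 1 / real (Suc N) - \<eta>"
        using y[of m] y[of n]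
      proof eventually_elim
        fix k assume k: "norm (u (s k) - y m) \<le> \<rho> + 1 / real (Suc m)"
          "norm (u (s k) - y n) \<le> \<rho> + 1 / real (Suc n)"
        have eq: "((u (s k) - y m) + (u (s k) - y n)) /\<^sub>R 2 = u (s k) - (y m + y n) /\<^sub>R 2"
          by (rule midpoint_diff)
        show "norm (u (s (id k)) - (y m + y n) /\<^sub>R 2) \<le> \<rho> + 1 / real (Suc N) - \<eta>"
          using mid[of "u (s k) - y m" "\<rho> + 1 / real (Suc N)" "u (s k) - y n"] k le far
          unfolding eq by (simp add: norm_minus_commute)
      qed
      from lower[OF _ this] N show False by (simp add: strict_mono_def)
    qed
    then show "\<exists>M. \<forall>m\<ge>M. \<forall>n\<ge>M. dist (y m) (y n) < e" by blast
  qed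
  then obtain x where x: "y \<longlonglongrightarrow> x" using Cauchy_convergent convergentD by blast
  have center: "\<forall>\<^sub>F k in sequentially. norm (u (s k) - x) \<le> \<rho> + e" if "e > 0" for e
  proof -
    have "\<forall>\<^sub>F n in sequentially. dist (y n) x < e / 2"
      using tendstoD[OF x, of "e / 2"] that by simp
    moreover have "\<forall>\<^sub>F n in sequentially. inverse (real (Suc n)) < e / 2"
      using order_tendstoD(2)[OF LIMSEQ_inverse_real_of_nat, of "e / 2"] that by simp
    ultimately have "\<forall>\<^sub>F n in sequentially. dist (y n) x < e / 2 \<and> inverse (real (Suc n)) < e / 2"
      by (rule eventually_conj)
    then obtain n where n: "dist (y n) x < e / 2" "1 / real (Suc n) < e / 2"
      using eventually_happens by (fastforce simp: inverse_eq_divide)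
    show ?thesis using y[of n]
    proof eventually_elim
      fix k assume "norm (u (s k) - y n) \<le> \<rho> + 1 / real (Suc n)"
      then show "norm (u (s k) - x) \<le> \<rho> + e"
        using n norm_triangle_ineq[of "u (s k) - y n" "y n - x"] by (simp add: dist_norm)
    qed
  qed
  have "delta_conv (\<lambda>k. u (s k)) x"
    unfolding delta_conv_iff
  proof (intro allI impI, rule ccontr)
    fix z and e :: real assume e: "e > 0"
    assume "\<not> (\<forall>\<^sub>F k in sequentially. norm (u (s k) - x) \<le> norm (u (s k) - z) + e)"
    from not_eventually_subseq[OF this] obtain t :: "nat \<Rightarrow> nat" where t: "strict_mono t"
      "\<And>k. norm (u (s (t k)) - x) > norm (u (s (t k)) - z) + e"
      by (auto simp: not_le)
    \<comment> \<open>A competitor \<open>z\<close> better by \<open>e\<close> along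
      \<open>t\<close> pushes the radius of that subsequence below \<open>\<rho>\<close>; regularity
      of \<open>s\<close> excludes this. Without regularity \<open>x\<close> would be a center of
      the whole sequence only.\<close>
    have "\<forall>\<^sub>F k in sequentially. norm (u (s (t k)) - z) \<le> \<rho> - e / 2"
      using eventually_subseq[OF t(1) center[of "e / 2"]] e
    proof (simp, elim eventually_mono)
      fix k assume "norm (u (s (t k)) - x) \<le> \<rho> + e / 2"
      then show "norm (u (s (t k)) - z) \<le> \<rho> - e / 2" using t(2)[of k] by simp
    qed
    from lower[OF t(1) this] e show False by simp
  qed
  with s show ?thesis by blast
qed

text \<open>Restrict to indices where a fixed \<open>z\<close> beats \<open>x\<close> by
  \<open>e\<close>, then take any \<Delta>-limit there: no \<Delta>-limit can be beaten in this way,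
  so it differs from \<open>x\<close>. This turns failure of \<Delta>-nullity into a nonzero
  profile.\<close>

lemma not_delta_conv_subseq:
  assumes uc: "uniformly_convex TYPE('a::banach)" and bdd: "bounded (range (u :: nat \<Rightarrow> 'a))"
    and not: "\<not> delta_conv u x"
  shows "\<exists>s p. strict_mono s \<and> delta_conv (\<lambda>k. u (s k)) p \<and> p \<noteq> x"
proof -
  obtain z e where e: "e > 0"
    and ne: "\<not> (\<forall>\<^sub>F k in sequentially. norm (u k - x) \<le> norm (u k - z) + e)"
    using not unfolding delta_conv_iff by blast
  from not_eventually_subseq[OF ne] obtain t :: "nat \<Rightarrow> nat" where t: "strict_mono t"
    "\<And>k. norm (u (t k) - x) > norm (u (t k) - z) + e"
    by (auto simp: not_le)
  have "bounded (range (\<lambda>k. u (t k)))" by (rule bounded_subset[OF bdd]) auto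
  then obtain r p where r: "strict_mono r" "delta_conv (\<lambda>k. u (t (r k))) p"
    using delta_compact[OF uc] by blast
  have "p \<noteq> x"
  proof
    assume "p = x"
    have "\<exists>k. norm (u (t (r k)) - p) \<le> norm (u (t (r k)) - z) + e"
      using eventually_happens[OF delta_convD[OF r(2) e, of z]] by simp
    then show False using t(2) \<open>p = x\<close> by (meson not_le)
  qed
  moreover have "strict_mono (t \<circ> r)" using t(1) r(1) by (rule strict_mono_o)
  moreover have "delta_conv (\<lambda>k. u ((t \<circ> r) k)) p" using r(2) by simp
  ultimately show ?thesis by blast
qed

section \<open>The modulus of convexity on balls\<close>

lemma strictly_convex:
  fixes x y :: "'a::real_normed_vector"
  assumes uc: "uniformly_convex TYPE('a)" and "norm x \<le> R" "norm y \<le> R" "x \<noteq> y"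
  shows "norm ((x + y) /\<^sub>R 2) < R"
proof -
  obtain \<eta> where "\<eta> > 0" and
    \<eta>: "\<And>(a::'a) b S. norm a \<le> S \<Longrightarrow> norm b \<le> S \<Longrightarrow> S \<le> R \<Longrightarrow> norm (x - y) \<le> norm (a - b) \<Longrightarrow>
       norm ((a + b) /\<^sub>R 2) \<le> S - \<eta>"
    using uniformly_convex_scaled[OF uc, of "norm (x - y)" R] assms(4) by auto
  show ?thesis using \<eta>[OF assms(2,3)] \<open>\<eta> > 0\<close> by simp
qed

text \<open>Coordinates in the plane of two independent vectors are controlled by the norm, by
  compactness of the unit circle. It supplies the compactness needed for maximization in a plane of
  a possibly infinite-dimensional space.\<close>

lemma norm_plane_lower_bound:
  fixes p d :: "'a::real_normed_vector"
  assumes "d \<noteq> 0" "\<And>t. p \<noteq> t *\<^sub>R d"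
  shows "\<exists>\<mu>>0. \<forall>z::real \<times> real. \<mu> * norm z \<le> norm (fst z *\<^sub>R p + snd z *\<^sub>R d)"
proof -
  define L where "L z = fst z *\<^sub>R p + snd z *\<^sub>R d" for z :: "real \<times> real"
  have cont: "continuous_on UNIV L" unfolding L_def by (intro continuous_intros)
  have "compact (sphere 0 1 :: (real \<times> real) set)" by simp
  moreover have "(1, 0) \<in> (sphere 0 1 :: (real \<times> real) set)" by (simp add: norm_Pair)
  then have "(sphere 0 1 :: (real \<times> real) set) \<noteq> {}" by blast
  moreover have "continuous_on (sphere 0 1) (\<lambda>z. norm (L z))"
    by (intro continuous_on_norm continuous_on_subset[OF cont]) simp
  ultimately obtain z0 where z0: "z0 \<in> sphere 0 1" "\<And>z. z \<in> sphere 0 1 \<Longrightarrow> norm (L z0) \<le> norm (L z)"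
    using continuous_attains_inf[of "sphere 0 1" "\<lambda>z. norm (L z)"] by blast
  have "L z0 \<noteq> 0"
  proof
    assume *: "L z0 = 0"
    show False
    proof (cases "fst z0 = 0")
      case True
      then have "snd z0 = 0" using * assms(1) by (simp add: L_def)
      then have "z0 = 0" using True by (simp add: prod_eq_iff)
      then show False using z0(1) by simp
    next
      case False
      have "fst z0 *\<^sub>R p = fst z0 *\<^sub>R ((- snd z0 / fst z0) *\<^sub>R d)"
        using * False by (simp add: L_def eq_neg_iff_add_eq_0)
      then have "p = (- snd z0 / fst z0) *\<^sub>R d" using False by (simp only: scaleR_cancel_left) simp
      then show False using assms(2) by blast
    qed
  qed
  then have pos: "norm (L z0) > 0" by simp
  have "norm (L z0) * norm z \<le> norm (L z)" for z
  proof (cases "z = 0")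
    case False
    have "norm (L z0) \<le> norm (L (z /\<^sub>R norm z))" using False by (intro z0(2)) simp
    also have "L (z /\<^sub>R norm z) = L z /\<^sub>R norm z" by (simp add: L_def scaleR_add_right)
    finally show ?thesis using False by (simp add: field_simps)
  qed simp
  with pos show ?thesis unfolding L_def by blast
qed

text \<open>Otherwise \<open>c\<close> could be moved in the direction of \<open>c /\<^sub>R norm c - (c - d)\<close> without leaving
  the constraint set or decreasing the norm, against strict convexity.\<close>
lemma maximal_translate:
  fixes c d :: "'a::real_normed_vector"
  assumes uc: "uniformly_convex TYPE('a)" and E: "subspace E" "c \<in> E" "d \<in> E" "c \<noteq> 0"
    and c: "norm (c + d) < 1" "norm (c - d) \<le> 1"
    and max: "\<And>y. y \<in> E \<Longrightarrow> norm (y + d) \<le> 1 \<Longrightarrow> norm (y - d) \<le> 1 \<Longrightarrow> norm y \<le> norm c"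
  shows "c - d = c /\<^sub>R norm c"
proof (rule ccontr)
  assume ne: "c - d \<noteq> c /\<^sub>R norm c"
  define e where "e = c /\<^sub>R norm c"
  define f where "f = e - (c - d)"
  have e: "norm e = 1" using E(4) by (simp add: e_def)
  have f: "f \<in> E" "f \<noteq> 0" "norm f \<le> 2"
    using E ne norm_triangle_ineq4[of e "c - d"] e c
    by (auto simp: f_def e_def intro: subspace_diff subspace_scale)
  \<comment> \<open>Moving by \<open>\<tau> *\<^sub>R f\<close> costs at most
    \<open>2 * \<tau>\<close>, exactly the slack in \<open>norm (c + d) < 1\<close>; and
    \<open>\<tau> \<le> 1\<close> makes \<open>c + \<tau> *\<^sub>R f - d\<close> a convex
    combination of \<open>c - d\<close> and \<open>e\<close>.\<close>
  define \<tau> where "\<tau> = (1 - norm (c + d)) / 2"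
  have "0 < \<tau>" using c(1) by (simp add: \<tau>_def)
  moreover have "- 1 \<le> norm (c + d)" by (rule order_trans[OF _ norm_ge_zero]) simp
  ultimately have \<tau>: "0 < \<tau>" "\<tau> \<le> 1" by (simp_all add: \<tau>_def)
  \<comment> \<open>\<open>c + t *\<^sub>R f\<close> is \<open>c + t *\<^sub>R e\<close> minus
    \<open>t *\<^sub>R (c - d)\<close>: the first has norm exactly \<open>norm c + t\<close>, as
    \<open>e\<close> points along \<open>c\<close>, and the second at most \<open>t\<close>.\<close>
  have ge: "norm c \<le> norm (c + t *\<^sub>R f)" if "0 \<le> t" for t
  proof -
    have "norm (c + t *\<^sub>R e) = norm ((1 + t / norm c) *\<^sub>R c)"
      using E(4) by (simp add: e_def scaleR_add_left inverse_eq_divide)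
    also have "\<dots> = norm c + t" using that E(4) by (simp add: field_simps)
    finally have "norm c + t = norm (c + t *\<^sub>R e)" ..
    also have "\<dots> \<le> norm (c + t *\<^sub>R f) + norm (t *\<^sub>R (c - d))"
      using norm_triangle_ineq[of "c + t *\<^sub>R f" "t *\<^sub>R (c - d)"]
      by (simp add: f_def scaleR_diff_right)
    also have "norm (t *\<^sub>R (c - d)) \<le> t" using c(2) that by (simp add: mult_left_le)
    finally show ?thesis by simp
  qed
  have le: "norm (c + \<tau> *\<^sub>R f) \<le> norm c"
  proof (rule max)
    show "c + \<tau> *\<^sub>R f \<in> E" using E f by (intro subspace_add subspace_scale)
    have "norm (c + \<tau> *\<^sub>R f + d) \<le> norm (c + d) + norm (\<tau> *\<^sub>R f)"
      using norm_triangle_ineq[of "c + d" "\<tau> *\<^sub>R f"] by (simp add: algebra_simps)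
    also have "norm (\<tau> *\<^sub>R f) \<le> \<tau> * 2" using f(3) \<tau> by simp
    also have "\<tau> * 2 = 1 - norm (c + d)" by (simp add: \<tau>_def)
    finally show "norm (c + \<tau> *\<^sub>R f + d) \<le> 1" by simp
    have "c + \<tau> *\<^sub>R f - d = (1 - \<tau>) *\<^sub>R (c - d) + \<tau> *\<^sub>R e"
      by (simp add: f_def algebra_simps)
    then have "norm (c + \<tau> *\<^sub>R f - d) \<le> (1 - \<tau>) * norm (c - d) + \<tau> * norm e"
      using norm_triangle_ineq[of "(1 - \<tau>) *\<^sub>R (c - d)" "\<tau> *\<^sub>R e"] \<tau> by simp
    also have "\<dots> \<le> (1 - \<tau>) * 1 + \<tau> * 1" using \<tau> c(2) e by (intro add_mono mult_left_mono) auto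
    finally show "norm (c + \<tau> *\<^sub>R f - d) \<le> 1" by simp
  qed
  have "norm ((c + (c + \<tau> *\<^sub>R f)) /\<^sub>R 2) < norm c"
    using \<tau> f(2) le by (intro strictly_convex[OF uc]) auto
  moreover have "(c + (c + \<tau> *\<^sub>R f)) /\<^sub>R 2 = c + (\<tau> / 2) *\<^sub>R f"
    using midpoint_diff[of c 0 "- \<tau> *\<^sub>R f"] by simp
  ultimately have "norm (c + (\<tau> / 2) *\<^sub>R f) < norm c" by (simp only:)
  then show False using ge[of "\<tau> / 2"] \<tau> by simp
qed

text \<open>Take \<open>c\<close> of maximal norm in the plane of \<open>p\<close> and
  \<open>d\<close> subject to both constraints \<open>\<le> 1\<close>. If
  \<open>c \<noteq> 0\<close> and a constraint is slack, \<open>maximal_translate\<close> forces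
  \<open>d\<close> to be parallel to \<open>c\<close> with \<open>norm d = 1 - norm c\<close>. Then
  every vector of norm \<open>norm c\<close> in the plane is a maximizer as well, and one not
  parallel to \<open>d\<close> must touch both constraints.\<close>

lemma translate_to_sphere_in_plane:
  fixes c0 d p :: "'a::real_normed_vector"
  assumes uc: "uniformly_convex TYPE('a)" and d: "d \<noteq> 0" and p: "\<And>t. p \<noteq> t *\<^sub>R d"
    and c0: "c0 = \<alpha> *\<^sub>R p + \<beta> *\<^sub>R d" "norm (c0 + d) \<le> 1" "norm (c0 - d) \<le> 1"
  shows "\<exists>c. norm (c + d) = 1 \<and> norm (c - d) = 1 \<and> norm c0 \<le> norm c"
proof -
  define L where "L z = fst z *\<^sub>R p + snd z *\<^sub>R d" for z :: "real \<times> real"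
  define E where "E = range L"
  have E_iff: "y \<in> E \<longleftrightarrow> (\<exists>a b. y = a *\<^sub>R p + b *\<^sub>R d)" for y
    unfolding E_def L_def by (auto simp: image_iff)
  have "linear L"
    unfolding L_def by (rule linearI) (simp_all add: algebra_simps)
  then have E: "subspace E" unfolding E_def by (simp add: linear_subspace_image)
  have pE: "p \<in> E" unfolding E_iff by (intro exI[of _ 1] exI[of _ 0]) simp
  have dE: "d \<in> E" unfolding E_iff by (intro exI[of _ 0] exI[of _ 1]) simp
  have c0E: "c0 \<in> E" using c0(1) unfolding E_iff by blast
  obtain \<mu> where \<mu>: "\<mu> > 0" "\<And>z. \<mu> * norm z \<le> norm (L z)"
    using norm_plane_lower_bound[OF d p] unfolding L_def by blast
  define C where "C = {z. norm (L z + d) \<le> 1 \<and> norm (L z - d) \<le> 1}"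
  have cont: "continuous_on UNIV L" unfolding L_def by (intro continuous_intros)
  have "norm z \<le> 1 / \<mu>" if "z \<in> C" for z
  proof -
    have "norm (L z) \<le> 1"
      using that norm_midpoint_le[of "L z + d" 1 "L z - d"] midpoint_diff[of "L z" d "- d"]
      by (simp add: C_def add.commute)
    then have "\<mu> * norm z \<le> 1" using \<mu>(2)[of z] by linarith
    then show ?thesis using \<mu>(1) by (simp add: field_simps)
  qed
  then have "bounded C" unfolding bounded_iff by blast
  moreover have "closed C"
    unfolding C_def by (intro closed_Collect_conj closed_Collect_le continuous_intros cont)
  ultimately have "compact C" by (simp add: compact_eq_bounded_closed)
  moreover have "(\<alpha>, \<beta>) \<in> C" using c0 unfolding C_def L_def by simp
  then have "C \<noteq> {}" by blast
  moreover have "continuous_on C (\<lambda>z. norm (L z))"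
    by (intro continuous_on_norm continuous_on_subset[OF cont]) simp
  ultimately obtain z where z: "z \<in> C" "\<And>y. y \<in> C \<Longrightarrow> norm (L y) \<le> norm (L z)"
    using continuous_attains_sup[of C "\<lambda>z. norm (L z)"] by blast
  define c where "c = L z"
  have c: "norm (c + d) \<le> 1" "norm (c - d) \<le> 1" "c \<in> E"
    using z(1) by (auto simp: c_def C_def E_def)
  have max: "norm y \<le> norm c" if "y \<in> E" "norm (y + d) \<le> 1" "norm (y - d) \<le> 1" for y
    using that z(2) unfolding c_def C_def E_def by auto
  have c0c: "norm c0 \<le> norm c" using c0 c0E by (intro max)
  \<comment> \<open>Stated for every maximizer \<open>b\<close>, since a second one replaces
    \<open>c\<close> below; the two halves use \<open>d\<close> and \<open>- d\<close>.\<close>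
  have touch: "norm (b + d) = 1 \<or> b - d = b /\<^sub>R norm b" "norm (b - d) = 1 \<or> b + d = b /\<^sub>R norm b"
    if b: "b \<in> E" "b \<noteq> 0" "norm b = norm c" "norm (b + d) \<le> 1" "norm (b - d) \<le> 1" for b
    using maximal_translate[OF uc E b(1) dE b(2) _ b(5)]
      maximal_translate[OF uc E b(1) subspace_neg[OF E dE] b(2), simplified, OF _ b(4)]
      max b by fastforce+
  show ?thesis
  proof (cases "c = 0")
    case True
    have p0: "p \<noteq> 0" using p[of 0] by simp
    have "norm d = 1"
    proof (rule ccontr)
      assume "norm d \<noteq> 1"
      then have d1: "norm d < 1" using c True by simp
      \<comment> \<open>If \<open>norm d < 1\<close>, the remaining room admits a nonzero multiple
        of \<open>p\<close>, so 0 would not be maximal.\<close>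
      define q where "q = ((1 - norm d) / norm p) *\<^sub>R p"
      have q: "norm q = 1 - norm d" using p0 d1 by (simp add: q_def)
      have "norm q \<le> norm c"
      proof (rule max)
        show "q \<in> E" using pE E by (simp add: q_def subspace_scale)
      qed (use q norm_triangle_ineq[of q d] norm_triangle_ineq4[of q d] in auto)
      then show False using q d1 True by simp
    qed
    then show ?thesis using True c0c by (intro exI[of _ 0]) simp
  next
    case False
    show ?thesis
    proof (cases "norm (c + d) = 1 \<and> norm (c - d) = 1")
      case True
      then show ?thesis using c0c by blast
    next
      case nt: False
      have c1: "norm c \<le> 1"
        using c norm_midpoint_le[of "c + d" 1 "c - d"] midpoint_diff[of c d "- d"]
        by (simp add: add.commute)
      have "c - d = c /\<^sub>R norm c \<or> c + d = c /\<^sub>R norm c"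
        using touch[OF c(3) False refl c(1,2)] nt by blast
      then have "norm d = norm (c /\<^sub>R norm c - c)"
        by (metis add_diff_cancel_left' add_diff_cancel_right' diff_add_cancel minus_diff_eq norm_minus_commute)
      also have "c /\<^sub>R norm c - c = (1 / norm c - 1) *\<^sub>R c"
        by (simp add: scaleR_diff_left inverse_eq_divide)
      also have "norm \<dots> = 1 - norm c"
        using False c1 by (simp add: field_simps)
      finally have nd: "norm d = 1 - norm c" .
      have p0: "p \<noteq> 0" using p[of 0] by simp
      define v where "v = (norm c / norm p) *\<^sub>R p"
      have v: "norm v = norm c" "v \<noteq> 0" "v \<in> E"
        using p0 False pE E by (auto simp: v_def subspace_scale)
      have v1: "norm (v + d) \<le> 1" "norm (v - d) \<le> 1"
        using norm_triangle_ineq[of v d] norm_triangle_ineq4[of v d] nd v(1) by auto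
      have par: False if "d = t *\<^sub>R v" for t
      proof -
        have "d = (t * norm c / norm p) *\<^sub>R p" using that by (simp add: v_def)
        moreover have "t * norm c / norm p \<noteq> 0" using d calculation by auto
        ultimately have "p = (1 / (t * norm c / norm p)) *\<^sub>R d"
          by (metis divide_inverse mult_1 right_inverse scaleR_one scaleR_scaleR mult.commute)
        then show False using p by blast
      qed
      have "norm (v + d) = 1"
      proof (rule ccontr)
        assume "norm (v + d) \<noteq> 1"
        then have "v - d = v /\<^sub>R norm v" using touch(1)[OF v(3,2,1) v1] by blast
        then have "d = (1 - 1 / norm v) *\<^sub>R v"
          by (simp add: scaleR_diff_left inverse_eq_divide algebra_simps)
        then show False by (rule par)
      qed
      moreover have "norm (v - d) = 1"
      proof (rule ccontr)
        assume "norm (v - d) \<noteq> 1"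
        then have "v + d = v /\<^sub>R norm v" using touch(2)[OF v(3,2,1) v1] by blast
        then have "d = (1 / norm v - 1) *\<^sub>R v"
          by (simp add: scaleR_diff_left inverse_eq_divide algebra_simps)
        then show False by (rule par)
      qed
      ultimately show ?thesis using v(1) c0c by auto
    qed
  qed
qed

lemma modulus_convexity_nonneg: "0 \<le> modulus_convexity TYPE('a::real_normed_vector) t"
proof -
  have "0 \<le> 1 - norm ((x + y) /\<^sub>R 2)" if "norm x = 1" "norm y = 1" for x y :: 'a
    using norm_midpoint_le[of x 1 y] that by simp
  then have "0 \<le> s" if "s \<in> {1 - norm ((x + y) /\<^sub>R 2) | x y::'a. norm x = 1 \<and> norm y = 1 \<and> norm (x - y) = t}" for s
    using that by blast
  then show ?thesis
    unfolding modulus_convexity_def Let_def by (simp only: split: if_split) (blast intro: cInf_greatest)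
qed

lemma modulus_convexity_le:
  fixes x y :: "'a::real_normed_vector"
  assumes "norm x = 1" "norm y = 1"
  shows "modulus_convexity TYPE('a) (norm (x - y)) \<le> 1 - norm ((x + y) /\<^sub>R 2)"
proof -
  define S where "S = {1 - norm ((a + b) /\<^sub>R 2) | a b::'a. norm a = 1 \<and> norm b = 1 \<and> norm (a - b) = norm (x - y)}"
  have in_S: "1 - norm ((x + y) /\<^sub>R 2) \<in> S" unfolding S_def using assms by blast
  have "0 \<le> 1 - norm ((a + b) /\<^sub>R 2)" if "norm a = 1" "norm b = 1" for a b :: 'a
    using norm_midpoint_le[of a 1 b] that by simp
  then have "bdd_below S" unfolding S_def by (intro bdd_belowI[of _ 0]) blast
  then have "Inf S \<le> 1 - norm ((x + y) /\<^sub>R 2)" using in_S by (intro cInf_lower)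
  moreover have "modulus_convexity TYPE('a) (norm (x - y)) = Inf S"
    using in_S unfolding modulus_convexity_def Let_def S_def by auto
  ultimately show ?thesis by simp
qed

text \<open>The modulus is defined by pairs on the unit sphere; this extends it to pairs in a smaller
  ball, with the sharp gain \<open>1 - R\<close> that makes the energy estimates add up.\<close>
lemma modulus_convexity_ball:
  fixes a b :: "'a::real_normed_vector"
  assumes uc: "uniformly_convex TYPE('a)" and ab: "norm a \<le> R" "norm b \<le> R" "R \<le> 1"
  shows "modulus_convexity TYPE('a) (norm (a - b)) \<le> R - norm ((a + b) /\<^sub>R 2)"
proof (cases "\<exists>x y::'a. norm x = 1 \<and> norm y = 1 \<and> norm (x - y) = norm (a - b)")
  case False
  \<comment> \<open>No unit vectors have this distance, so the convention for the empty set
    applies.\<close>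
  then have "modulus_convexity TYPE('a) (norm (a - b)) = 0"
    unfolding modulus_convexity_def Let_def by auto
  then show ?thesis using norm_midpoint_le[OF ab(1,2)] by simp
next
  case True
  then obtain x y :: 'a where xy: "norm x = 1" "norm y = 1" "norm (x - y) = norm (a - b)" by blast
  define z where "z = (a + b) /\<^sub>R 2"
  define d where "d = (a - b) /\<^sub>R 2"
  define e where "e = (if z = 0 then x else z /\<^sub>R norm z)"
  \<comment> \<open>Pushing the midpoint outwards by \<open>1 - R\<close> along its own direction
    raises its norm by exactly \<open>1 - R\<close>, while both endpoints, of norm at most
    \<open>R\<close>, stay in the unit ball. For \<open>z = 0\<close> any unit direction will do,
    and \<open>x\<close> is one.\<close>
  define c0 where "c0 = z + (1 - R) *\<^sub>R e"
  have zd: "z + d = a" "z - d = b"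
    unfolding z_def d_def by (simp_all add: algebra_simps flip: scaleR_add_left)
  have e: "norm e = 1" using xy by (simp add: e_def)
  have "c0 = (norm z + (1 - R)) *\<^sub>R e"
    unfolding c0_def by (auto simp: e_def scaleR_add_left)
  then have c0n: "norm c0 = norm z + (1 - R)" using e ab(3) by simp
  have "norm (c0 + d) \<le> norm (z + d) + norm ((1 - R) *\<^sub>R e)"
    using norm_triangle_ineq[of "z + d" "(1 - R) *\<^sub>R e"] by (simp add: c0_def algebra_simps)
  then have c1: "norm (c0 + d) \<le> 1" using e ab zd by simp
  have "norm (c0 - d) \<le> norm (z - d) + norm ((1 - R) *\<^sub>R e)"
    using norm_triangle_ineq[of "z - d" "(1 - R) *\<^sub>R e"] by (simp add: c0_def algebra_simps)
  then have c2: "norm (c0 - d) \<le> 1" using e ab zd by simp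
  have "\<exists>c. norm (c + d) = 1 \<and> norm (c - d) = 1 \<and> norm c0 \<le> norm c"
  proof (cases "d = 0")
    case True
    then show ?thesis using c1 xy by (intro exI[of _ x]) simp
  next
    case d: False
    show ?thesis
    proof (cases "\<exists>p. \<forall>t. p \<noteq> t *\<^sub>R d")
      case True
      then obtain p where p: "\<And>t. p \<noteq> t *\<^sub>R d" by blast
      show ?thesis
      \<comment> \<open>A plane containing \<open>c0\<close> and \<open>d\<close> is wanted:
        \<open>c0\<close> spans it together with \<open>d\<close> unless the two are parallel, and
        then any independent \<open>p\<close> serves.\<close>
      proof (cases "\<exists>t. c0 = t *\<^sub>R d")
        case True
        then obtain t where "c0 = 0 *\<^sub>R p + t *\<^sub>R d" by auto
        from translate_to_sphere_in_plane[OF uc d p this c1 c2] show ?thesis .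
      next
        case False
        then have nc: "\<And>t. c0 \<noteq> t *\<^sub>R d" by blast
        have "c0 = 1 *\<^sub>R c0 + 0 *\<^sub>R d" by simp
        from translate_to_sphere_in_plane[OF uc d nc this c1 c2] show ?thesis .
      qed
    next
      case False
      \<comment> \<open>The space is a line, hence \<open>x = - y\<close> and \<open>norm d = 1\<close>.\<close>
      then have line: "\<exists>t. p = t *\<^sub>R d" for p by blast
      obtain s t where st: "x = s *\<^sub>R d" "y = t *\<^sub>R d" using line by metis
      have nd: "norm d > 0" using d by simp
      have "\<bar>s\<bar> * norm d = 1" "\<bar>t\<bar> * norm d = 1" using xy st by simp_all
      then have abs_eq: "\<bar>s\<bar> = \<bar>t\<bar>" using nd by (metis mult_right_cancel less_irrefl)
      have "norm (x - y) = 2 * norm d" using xy(3) by (simp add: d_def)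
      moreover have "x - y = (s - t) *\<^sub>R d" using st by (simp add: scaleR_diff_left)
      ultimately have "\<bar>s - t\<bar> = 2" using nd by simp
      then have "\<bar>s\<bar> = 1" using abs_eq by linarith
      then have d1: "norm d = 1" using \<open>\<bar>s\<bar> * norm d = 1\<close> by simp
      obtain r where r: "c0 = r *\<^sub>R d" using line by blast
      have "c0 + d = (r + 1) *\<^sub>R d" "c0 - d = (r - 1) *\<^sub>R d"
        using r by (simp_all add: algebra_simps)
      then have "\<bar>r + 1\<bar> \<le> 1" "\<bar>r - 1\<bar> \<le> 1" using c1 c2 d1 by simp_all
      then have "r = 0" by linarith
      then show ?thesis using r d1 by (intro exI[of _ 0]) simp
    qed
  qed
  then obtain c where c: "norm (c + d) = 1" "norm (c - d) = 1" "norm c0 \<le> norm c" by blast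
  have "modulus_convexity TYPE('a) (norm ((c + d) - (c - d))) \<le> 1 - norm (((c + d) + (c - d)) /\<^sub>R 2)"
    using c by (intro modulus_convexity_le)
  moreover have "(c + d) - (c - d) = a - b" using zd by (simp add: algebra_simps)
  moreover have "((c + d) + (c - d)) /\<^sub>R 2 = c" using midpoint_diff[of c d "- d"] by (simp add: add.commute)
  ultimately show ?thesis using c(3) c0n by (simp add: z_def)
qed

section \<open>Greedy extraction of profiles\<close>

lemma half_maximal_norm:
  fixes S :: "'a::real_normed_vector set"
  assumes "S \<noteq> {}" "bounded S"
  shows "\<exists>p\<in>S. \<forall>q\<in>S. norm q \<le> 2 * norm p"
proof -
  have bdd: "bdd_above (norm ` S)"
    using assms(2) unfolding bounded_iff by (auto intro: bdd_aboveI2)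
  define M where "M = Sup (norm ` S)"
  have le: "norm q \<le> M" if "q \<in> S" for q
    unfolding M_def using bdd that by (intro cSup_upper) auto
  show ?thesis
  proof (cases "M > 0")
    case True
    then have "M / 2 < Sup (norm ` S)" unfolding M_def by simp
    then obtain p where p: "p \<in> S" "M / 2 < norm p"
      using less_cSupD[of "norm ` S" "M / 2"] assms(1) by auto
    then have "norm q \<le> 2 * norm p" if "q \<in> S" for q using le[OF that] by simp
    with p(1) show ?thesis by blast
  next
    case False
    obtain p where "p \<in> S" using assms(1) by blast
    moreover have "norm q \<le> 2 * norm p" if "q \<in> S" for q
      using le[OF that] False norm_ge_zero[of p] by linarith
    ultimately show ?thesis by blast
  qed
qed

lemma bij_linear_isometryD:
  assumes "bij_linear_isometry g"
  shows "linear g" "bij g" "norm (g x) = norm x" "inv g (g x) = x" "g (inv g x) = x"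
    "norm (inv g x) = norm x" "linear (inv g)"
proof -
  show g: "linear g" "bij g" "norm (g x) = norm x" for x
    using assms by (auto simp: bij_linear_isometry_def)
  show inv: "inv g (g x) = x" "g (inv g x) = x" for x
    using g(2) by (auto simp: bij_is_inj bij_is_surj surj_f_inv_f)
  show "norm (inv g x) = norm x" using g(3)[of "inv g x"] inv(2)[of x] by simp
  show "linear (inv g)"
  proof (rule linearI)
    fix x y and r :: real
    have "g (inv g x + inv g y) = x + y" by (simp add: linear_add[OF g(1)] inv)
    then show "inv g (x + y) = inv g x + inv g y" using inv(1) by metis
    have "g (r *\<^sub>R inv g x) = r *\<^sub>R x" by (simp add: linear_scale[OF g(1)] inv)
    then show "inv g (r *\<^sub>R x) = r *\<^sub>R inv g x" using inv(1) by metis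
  qed
qed

text \<open>The candidates are all \<Delta>-limits of \<open>inv (h i) (v (s (t i)))\<close>: there
  is one by compactness with \<open>h = id\<close>, and all are bounded because isometries preserve
  norms. Maximality is recorded relative to \<open>s\<close>, before refinement by \<open>r\<close>,
  and thus survives every later passage to a subsequence.\<close>

lemma maximal_profile_step:
  fixes v :: "nat \<Rightarrow> 'a::banach" and s :: "nat \<Rightarrow> nat"
  assumes uc: "uniformly_convex TYPE('a)"
    and D: "\<forall>g\<in>D. bij_linear_isometry g" "id \<in> D"
    and v: "bounded (range v)" and s: "strict_mono s"
  shows "\<exists>(r :: nat \<Rightarrow> nat) w g. strict_mono r \<and> range g \<subseteq> D \<and> bounded (range (\<lambda>k. v k - g k w)) \<and>
    convergent (\<lambda>i. norm (v (s (r i)) - g (s (r i)) w)) \<and>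
    delta_conv (\<lambda>i. inv (g (s (r i))) (v (s (r i)))) w \<and>
    (\<forall>(t :: nat \<Rightarrow> nat) h p. strict_mono t \<longrightarrow> range h \<subseteq> D \<longrightarrow> delta_conv (\<lambda>i. inv (h i) (v (s (t i)))) p \<longrightarrow>
      norm p \<le> 2 * norm w)"
proof -
  note D = bspec[OF D(1)] D(2)
  define \<P> where "\<P> = {p. \<exists>(t :: nat \<Rightarrow> nat) h. strict_mono t \<and> range h \<subseteq> D \<and> delta_conv (\<lambda>i. inv (h i) (v (s (t i)))) p}"
  obtain M where M: "\<And>k. norm (v k) \<le> M" using v unfolding bounded_iff by auto
  have "bounded (range (\<lambda>k. v (s k)))" by (rule bounded_subset[OF v]) auto
  from delta_compact[OF uc this] obtain t p where "strict_mono t" "delta_conv (\<lambda>k. v (s (t k))) p"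
    by blast
  then have "p \<in> \<P>"
    unfolding \<P>_def using D(2) by (auto intro!: exI[of _ t] exI[of _ "\<lambda>_. id"])
  then have "\<P> \<noteq> {}" by blast
  moreover have "bounded \<P>"
    unfolding bounded_iff
  proof (intro exI[of _ "2 * M"] ballI)
    fix p assume "p \<in> \<P>"
    then obtain t h where th: "range h \<subseteq> D" "delta_conv (\<lambda>i. inv (h i) (v (s (t i)))) p"
      unfolding \<P>_def by blast
    have "h i \<in> D" for i using th(1) by auto
    then have "norm (inv (h i) (v (s (t i)))) \<le> M" for i
      using bij_linear_isometryD(6)[OF D(1)] M by simp
    then show "norm p \<le> 2 * M" using delta_limit_norm_le[OF th(2)] by simp
  qed
  ultimately obtain w where w: "w \<in> \<P>" "\<And>q. q \<in> \<P> \<Longrightarrow> norm q \<le> 2 * norm w"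
    using half_maximal_norm[of \<P>] by blast
  then obtain t h where th: "strict_mono t" "range h \<subseteq> D" "delta_conv (\<lambda>i. inv (h i) (v (s (t i)))) w"
    unfolding \<P>_def by blast
  define s1 where "s1 = s \<circ> t"
  have s1: "strict_mono s1" unfolding s1_def using s th(1) by (rule strict_mono_o)
  \<comment> \<open>Indexing by the original sequence avoids reindexing at later stages.\<close>
  define g where "g k = (if k \<in> range s1 then h (inv s1 k) else id)" for k
  have gh: "g (s1 i) = h i" for i
    unfolding g_def using inv_f_f[OF strict_mono_imp_inj_on[OF s1]] by simp
  have gD: "range g \<subseteq> D" unfolding g_def using th(2) D(2) by auto
  have "norm (v k - g k w) \<le> M + norm w" for k
    using norm_triangle_ineq4[of "v k" "g k w"] M[of k] bij_linear_isometryD(3)[OF D(1), of "g k" w] gD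
    by fastforce
  then have bdd: "bounded (range (\<lambda>k. v k - g k w))" unfolding bounded_iff by blast
  have "bounded (range (\<lambda>i. norm (v (s1 i) - g (s1 i) w)))"
    using bdd unfolding bounded_iff by auto
  from bounded_imp_convergent_subsequence[OF this]
  obtain l r where r: "strict_mono r" "(\<lambda>i. norm (v (s1 (r i)) - g (s1 (r i)) w)) \<longlonglongrightarrow> l"
    by (auto simp: o_def)
  have dc: "delta_conv (\<lambda>i. inv (g (s1 (r i))) (v (s1 (r i)))) w"
    using delta_conv_subseq[OF th(3) r(1)] unfolding gh by (simp add: s1_def)
  have max: "\<forall>(t :: nat \<Rightarrow> nat) h p. strict_mono t \<longrightarrow> range h \<subseteq> D \<longrightarrow> delta_conv (\<lambda>i. inv (h i) (v (s (t i)))) p \<longrightarrow>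
      norm p \<le> 2 * norm w"
    using w(2) unfolding \<P>_def by blast
  have "strict_mono (t \<circ> r)" using th(1) r(1) by (rule strict_mono_o)
  moreover have "convergent (\<lambda>i. norm (v (s ((t \<circ> r) i)) - g (s ((t \<circ> r) i)) w))"
    using r(2) unfolding convergent_def by (auto simp: s1_def)
  moreover have "delta_conv (\<lambda>i. inv (g (s ((t \<circ> r) i))) (v (s ((t \<circ> r) i)))) w"
    using dc by (simp add: s1_def)
  ultimately show ?thesis using gD bdd max by blast
qed

text \<open>A stage consists of an index sequence, a remainder on the original indices, a profile
  and its dislocations. The diagonal index sequence keeps every asymptotic property because its
  tails are subsequences of each stage.\<close>

lemma greedy_extraction:
  fixes x :: "nat \<Rightarrow> 'a::banach"
  assumes uc: "uniformly_convex TYPE('a)"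
    and D: "\<forall>g\<in>D. bij_linear_isometry g" "id \<in> D"
    and x: "bounded (range x)"
  shows "\<exists>(s :: nat \<Rightarrow> nat) w g. strict_mono s \<and> (\<forall>n k. g n k \<in> D) \<and> (\<forall>k. g 0 k = id) \<and>
    (\<forall>n. delta_conv (\<lambda>k. inv (g n k) (x (s k) - (\<Sum>j<n. g j k (w j)))) (w n)) \<and>
    (\<forall>n. convergent (\<lambda>k. norm (x (s k) - (\<Sum>j<n. g j k (w j))))) \<and>
    (\<forall>n (t :: nat \<Rightarrow> nat) h p. strict_mono t \<longrightarrow> range h \<subseteq> D \<longrightarrow>
      delta_conv (\<lambda>i. inv (h i) (x (s (t i)) - (\<Sum>j<Suc n. g j (t i) (w j)))) p \<longrightarrow>
      norm p \<le> 2 * norm (w (Suc n)))"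
proof -
  define P where "P s v \<longleftrightarrow> strict_mono s \<and> bounded (range v) \<and> convergent (\<lambda>i. norm (v (s i)))"
    for s :: "nat \<Rightarrow> nat" and v :: "nat \<Rightarrow> 'a"
  \<comment> \<open>Stage 0 takes any \<Delta>-limit of \<open>x\<close> itself, so that its
    dislocation is the identity; half-maximality enters only through \<open>Q\<close>. Convergence
    of \<open>norm (x (s i))\<close> is listed here because \<open>P\<close> covers only the
    remainder after subtraction. Pairing the two norms below gives both limits along one
    subsequence.\<close>
  define P0 where "P0 s v w g \<longleftrightarrow> g = (\<lambda>_. id) \<and> v = (\<lambda>k. x k - w) \<and>
      delta_conv (\<lambda>i. x (s i)) w \<and> convergent (\<lambda>i. norm (x (s i)))"
    for s :: "nat \<Rightarrow> nat" and v w and g :: "nat \<Rightarrow> 'a \<Rightarrow> 'a"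
  define Q where "Q s v s' v' w g \<longleftrightarrow> (\<exists>r :: nat \<Rightarrow> nat. strict_mono r \<and> s' = s \<circ> r) \<and> range g \<subseteq> D \<and>
      v' = (\<lambda>k. v k - g k w) \<and> delta_conv (\<lambda>i. inv (g (s' i)) (v (s' i))) w \<and>
      (\<forall>(t :: nat \<Rightarrow> nat) h p. strict_mono t \<longrightarrow> range h \<subseteq> D \<longrightarrow> delta_conv (\<lambda>i. inv (h i) (v (s (t i)))) p \<longrightarrow>
        norm p \<le> 2 * norm w)"
    for s s' :: "nat \<Rightarrow> nat" and v v' w and g :: "nat \<Rightarrow> 'a \<Rightarrow> 'a"
  have "\<exists>f. \<forall>n. (case f n of (s, v, w, g) \<Rightarrow> P s v \<and> (n = 0 \<longrightarrow> P0 s v w g)) \<and>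
      (case (f n, f (Suc n)) of ((s, v, _, _), (s', v', w, g)) \<Rightarrow> Q s v s' v' w g)"
  proof (rule dependent_nat_choice)
    from delta_compact[OF uc x] obtain s w where s: "strict_mono s" "delta_conv (\<lambda>k. x (s k)) w"
      by blast
    have "bounded (range (\<lambda>k. (norm (x (s k)), norm (x (s k) - w))))"
    proof -
      obtain M where M: "\<And>k. norm (x k) \<le> M" using x unfolding bounded_iff by auto
      have "norm (norm (x (s k)), norm (x (s k) - w)) \<le> M + (M + norm w)" for k
        using norm_Pair_le[of "norm (x (s k))" "norm (x (s k) - w)"] M[of "s k"]
          norm_triangle_ineq4[of "x (s k)" w] by simp
      then show ?thesis unfolding bounded_iff by blast
    qed
    from bounded_imp_convergent_subsequence[OF this]
    obtain l r where r: "strict_mono r" "(\<lambda>k. (norm (x (s (r k))), norm (x (s (r k)) - w))) \<longlonglongrightarrow> l"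
      by (auto simp: o_def)
    have "(\<lambda>k. norm (x (s (r k)))) \<longlonglongrightarrow> fst l" "(\<lambda>k. norm (x (s (r k)) - w)) \<longlonglongrightarrow> snd l"
      using tendsto_fst[OF r(2)] tendsto_snd[OF r(2)] by simp_all
    then have c: "convergent (\<lambda>k. norm (x (s (r k))))" "convergent (\<lambda>k. norm (x (s (r k)) - w))"
      unfolding convergent_def by blast+
    have "strict_mono (s \<circ> r)" using s(1) r(1) by (rule strict_mono_o)
    moreover have "bounded (range (\<lambda>k. x k - w))"
      using bounded_translation_minus[OF x, of w] by (simp add: image_image)
    moreover have "delta_conv (\<lambda>i. x (s (r i))) w" using delta_conv_subseq[OF s(2) r(1)] .
    ultimately have "P (s \<circ> r) (\<lambda>k. x k - w) \<and> P0 (s \<circ> r) (\<lambda>k. x k - w) w (\<lambda>_. id)"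
      unfolding P_def P0_def using c by simp
    then show "\<exists>f. case f of (s, v, w, g) \<Rightarrow> P s v \<and> ((0::nat) = 0 \<longrightarrow> P0 s v w g)"
      by (intro exI[of _ "(s \<circ> r, \<lambda>k. x k - w, w, \<lambda>_. id)"]) simp
  next
    fix f :: "(nat \<Rightarrow> nat) \<times> (nat \<Rightarrow> 'a) \<times> 'a \<times> (nat \<Rightarrow> 'a \<Rightarrow> 'a)" and n :: nat
    assume f: "case f of (s, v, w, g) \<Rightarrow> P s v \<and> (n = 0 \<longrightarrow> P0 s v w g)"
    obtain s v w0 g0 where f_eq: "f = (s, v, w0, g0)" by (metis prod_cases4)
    have "strict_mono s" "bounded (range v)" using f unfolding f_eq P_def by auto
    from maximal_profile_step[OF uc D this(2,1)] obtain r w g where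
      r: "strict_mono r" "range g \<subseteq> D" "bounded (range (\<lambda>k. v k - g k w))"
        "convergent (\<lambda>i. norm (v (s (r i)) - g (s (r i)) w))"
        "delta_conv (\<lambda>i. inv (g (s (r i))) (v (s (r i)))) w"
        "\<forall>(t :: nat \<Rightarrow> nat) h p. strict_mono t \<longrightarrow> range h \<subseteq> D \<longrightarrow> delta_conv (\<lambda>i. inv (h i) (v (s (t i)))) p \<longrightarrow>
          norm p \<le> 2 * norm w"
      by blast
    have "P (s \<circ> r) (\<lambda>k. v k - g k w)"
      unfolding P_def using r strict_mono_o[OF \<open>strict_mono s\<close> r(1)] by simp
    moreover have "Q s v (s \<circ> r) (\<lambda>k. v k - g k w) w g"
      unfolding Q_def using r by (intro conjI exI[of _ r]) simp_all
    ultimately show "\<exists>f'. (case f' of (s, v, w, g) \<Rightarrow> P s v \<and> (Suc n = 0 \<longrightarrow> P0 s v w g)) \<and>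
        (case (f, f') of ((s, v, _, _), (s', v', w, g)) \<Rightarrow> Q s v s' v' w g)"
      unfolding f_eq by (intro exI[of _ "(s \<circ> r, \<lambda>k. v k - g k w, w, g)"]) simp
  qed
  then obtain f where f: "\<forall>n. (case f n of (s, v, w, g) \<Rightarrow> P s v \<and> (n = 0 \<longrightarrow> P0 s v w g)) \<and>
      (case (f n, f (Suc n)) of ((s, v, _, _), (s', v', w, g)) \<Rightarrow> Q s v s' v' w g)"
    by (rule exE)
  define S where "S n = fst (f n)" for n
  define V where "V n = fst (snd (f n))" for n
  define w where "w n = fst (snd (snd (f n)))" for n
  define G where "G n = snd (snd (snd (f n)))" for n
  have P: "P (S n) (V n)" for n
    using conjunct1[OF spec[OF f, of n]] by (simp add: S_def V_def case_prod_beta)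
  have P0: "P0 (S 0) (V 0) (w 0) (G 0)"
    using conjunct1[OF spec[OF f, of 0]] by (simp add: S_def V_def w_def G_def case_prod_beta)
  have Q: "Q (S n) (V n) (S (Suc n)) (V (Suc n)) (w (Suc n)) (G (Suc n))" for n
    using conjunct2[OF spec[OF f, of n]] by (simp add: S_def V_def w_def G_def case_prod_beta)
  have "\<exists>r :: nat \<Rightarrow> nat. strict_mono r \<and> S (Suc n) = S n \<circ> r" for n using Q[of n] unfolding Q_def by blast
  then obtain r where r: "\<And>n. strict_mono (r n)" "\<And>n. S (Suc n) = S n \<circ> r n" by metis
  have S0: "strict_mono (S 0)" using P unfolding P_def by blast
  obtain d :: "nat \<Rightarrow> nat" where d: "strict_mono d" and dd:
    "\<And>n t. strict_mono t \<Longrightarrow> \<exists>t'. strict_mono t' \<and> (\<forall>i. d (t (n + i)) = S n (t' i))"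
    using diagonal_subsequence[of r S, OF r(1) S0 r(2)] by blast
  have tail: "\<exists>t. strict_mono t \<and> (\<forall>i. d (n + i) = S n (t i))" for n
    using dd[of id n] by (simp add: strict_mono_def)
  have d_delta: "delta_conv (\<lambda>k. F (d k)) p" if "delta_conv (\<lambda>i. F (S n i)) p" for F :: "nat \<Rightarrow> 'a" and n p
  proof -
    obtain t where t: "strict_mono t" "\<And>i. d (n + i) = S n (t i)" using tail by blast
    have "delta_conv (\<lambda>i. F (d (n + i))) p" unfolding t(2) using that t(1) by (rule delta_conv_subseq)
    then show ?thesis by (rule delta_conv_shift)
  qed
  have d_conv: "convergent (\<lambda>k. F (d k))" if c: "convergent (\<lambda>i. F (S n i))" for F :: "nat \<Rightarrow> real" and n
  proof -
    obtain t where t: "strict_mono t" "\<And>i. d (n + i) = S n (t i)" using tail by blast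
    have "convergent (\<lambda>i. F (d (n + i)))"
      unfolding t(2) using convergent_subseq_convergent[OF c t(1)] by (simp add: o_def)
    then have "convergent (\<lambda>i. F (d (i + n)))" by (simp add: add.commute)
    then show ?thesis by (simp only: convergent_ignore_initial_segment[of "\<lambda>k. F (d k)"])
  qed
  have V: "V n k = x k - (\<Sum>j<Suc n. G j k (w j))" for n k
  proof (induction n)
    case 0
    then show ?case using P0 by (simp add: P0_def)
  next
    case (Suc n)
    then show ?case using Q[of n] by (simp add: Q_def)
  qed
  have GD: "G n k \<in> D" for n k
    using P0 Q[of "n - 1"] D(2) unfolding P0_def Q_def by (cases n) auto
  have G0: "G 0 k = id" for k using P0 unfolding P0_def by simp
  have prof: "delta_conv (\<lambda>k. inv (G n (d k)) (x (d k) - (\<Sum>j<n. G j (d k) (w j)))) (w n)" for n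
  proof (cases n)
    case 0
    then show ?thesis using P0 d_delta[of x 0 "w 0"] unfolding P0_def by simp
  next
    case (Suc m)
    have "delta_conv (\<lambda>i. inv (G n (S n i)) (V m (S n i))) (w n)" using Q[of m] Suc unfolding Q_def by simp
    from d_delta[of "\<lambda>k. inv (G n k) (V m k)", OF this] show ?thesis unfolding V Suc .
  qed
  have conv: "convergent (\<lambda>k. norm (x (d k) - (\<Sum>j<n. G j (d k) (w j))))" for n
  proof (cases n)
    case 0
    then show ?thesis using P0 d_conv[of "\<lambda>k. norm (x k)" 0] unfolding P0_def by simp
  next
    case (Suc m)
    have "convergent (\<lambda>k. norm (V m (S m k)))" using P[of m] unfolding P_def by simp
    from d_conv[of "\<lambda>k. norm (V m k)", OF this] show ?thesis unfolding V Suc .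
  qed
  have max: "norm p \<le> 2 * norm (w (Suc n))"
    if t: "strict_mono t" and h: "range h \<subseteq> D"
      and p: "delta_conv (\<lambda>i. inv (h i) (x (d (t i)) - (\<Sum>j<Suc n. G j (d (t i)) (w j)))) p" for n h p and t :: "nat \<Rightarrow> nat"
  proof -
    \<comment> \<open>A subsequence of the diagonal is a subsequence of \<open>S n\<close> only
      after dropping \<open>n\<close> terms, which does not affect the \<Delta>-limit;
      \<open>h\<close> is shifted along.\<close>
    obtain t' where t': "strict_mono t'" "\<And>i. d (t (n + i)) = S n (t' i)" using dd[OF t] by blast
    have "delta_conv (\<lambda>i. inv (h i) (V n (d (t i)))) p" using p unfolding V .
    then have "delta_conv (\<lambda>i. inv (h (n + i)) (V n (d (t (n + i))))) p"
      by (rule delta_conv_subseq) (simp add: strict_mono_def)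
    then have "delta_conv (\<lambda>i. inv (h (n + i)) (V n (S n (t' i)))) p" unfolding t'(2) .
    moreover have "range (\<lambda>i. h (n + i)) \<subseteq> D" using h by auto
    ultimately show ?thesis
      using Q[of n] t'(1) unfolding Q_def by (elim conjE allE[of _ t'] allE[of _ "\<lambda>i. h (n + i)"]) simp
  qed
  show ?thesis
    by (rule exI[of _ d], rule exI[of _ w], rule exI[of _ "\<lambda>n k. G n (d k)"])
       (intro conjI allI impI d GD G0 prof conv max)
qed

section \<open>Decoupling and summability of the profiles\<close>

text \<open>For each fixed \<open>k\<close> all but finitely many terms are outside the range where the tail estimates
  apply. Cut the indices into blocks whose sums are eventually at most \<open>(1/2) ^ i\<close>; on the \<open>i\<close>-th
  block, the sequences are frozen until that estimate is in force.\<close>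
lemma rearranged_uncond_sum:
  fixes F :: "nat \<Rightarrow> nat \<Rightarrow> 'a::banach"
  assumes tails: "\<And>e. e > 0 \<Longrightarrow> \<exists>m. \<forall>J. finite J \<longrightarrow> J \<subseteq> {m..} \<longrightarrow>
    (\<forall>\<^sub>F k in sequentially. norm (\<Sum>j\<in>J. F j k) < e)"
  shows "\<exists>K S. unif_uncond_sum (\<lambda>j k. F j (max k (K j))) S"
proof -
  have "\<exists>m. \<forall>J. finite J \<longrightarrow> J \<subseteq> {m..} \<longrightarrow>
    (\<forall>\<^sub>F k in sequentially. norm (\<Sum>j\<in>J. F j k) < (1/2) ^ i)" for i
    by (rule tails) simp
  then obtain m where m: "\<And>i J. finite J \<Longrightarrow> J \<subseteq> {m i..} \<Longrightarrow>
    \<forall>\<^sub>F k in sequentially. norm (\<Sum>j\<in>J. F j k) < (1/2) ^ i" by metis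
  \<comment> \<open>Cumulative sums make the thresholds strictly increasing while staying above
    \<open>m i\<close>.\<close>
  define N where "N i = (\<Sum>l\<le>i. Suc (m l))" for i
  have Nm: "m i \<le> N i" for i unfolding N_def by (cases i) auto
  have N: "strict_mono N" unfolding strict_mono_Suc_iff N_def by simp
  have N_le: "N i \<le> N j \<longleftrightarrow> i \<le> j" for i j using strict_mono_less_eq[OF N] .
  have "\<exists>\<kappa>. \<forall>k\<ge>\<kappa>. \<forall>J\<in>Pow {N i..<N (Suc i)}. norm (\<Sum>j\<in>J. F j k) < (1/2) ^ i" for i
  proof -
    have "\<forall>J\<in>Pow {N i..<N (Suc i)}. \<forall>\<^sub>F k in sequentially. norm (\<Sum>j\<in>J. F j k) < (1/2) ^ i"
    proof
      fix J assume "J \<in> Pow {N i..<N (Suc i)}"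
      then have "J \<subseteq> {N i..<N (Suc i)}" by simp
      then show "\<forall>\<^sub>F k in sequentially. norm (\<Sum>j\<in>J. F j k) < (1/2) ^ i"
        using Nm[of i] by (intro m) (auto dest: finite_subset)
    qed
    then have "\<forall>\<^sub>F k in sequentially. \<forall>J\<in>Pow {N i..<N (Suc i)}. norm (\<Sum>j\<in>J. F j k) < (1/2) ^ i"
      by (intro eventually_ball_finite) auto
    then show ?thesis unfolding eventually_sequentially .
  qed
  then obtain \<kappa> where \<kappa>: "\<And>i k J. k \<ge> \<kappa> i \<Longrightarrow> J \<subseteq> {N i..<N (Suc i)} \<Longrightarrow>
      norm (\<Sum>j\<in>J. F j k) < (1/2) ^ i" by (metis PowI)
  \<comment> \<open>The least \<open>i\<close> is the block of \<open>j\<close>. Indices below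
    \<open>N 0\<close> lie in no block and occur only in the finite head of the sum, where no
    smallness is claimed.\<close>
  define K where "K j = \<kappa> (LEAST i. j < N (Suc i))" for j
  have K: "K j = \<kappa> i" if "j \<in> {N i..<N (Suc i)}" for i j
  proof -
    have "(LEAST i. j < N (Suc i)) = i"
    proof (rule Least_equality)
      fix y assume "j < N (Suc y)"
      then have "N i < N (Suc y)" using that by simp
      then show "i \<le> y" using strict_mono_less[OF N] by simp
    qed (use that in simp)
    then show ?thesis by (simp add: K_def)
  qed
  define F' where "F' j k = F j (max k (K j))" for j k
  have block: "norm (\<Sum>j\<in>J. F' j k) \<le> (1/2) ^ i" if J: "J \<subseteq> {N i..<N (Suc i)}" for J i k
  proof -
    have "(\<Sum>j\<in>J. F' j k) = (\<Sum>j\<in>J. F j (max k (\<kappa> i)))"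
      unfolding F'_def using J K by (intro sum.cong) auto
    then show ?thesis using \<kappa>[OF _ J, of "max k (\<kappa> i)"] by simp
  qed
  \<comment> \<open>The right-hand side is the geometric sum of \<open>(1/2) ^ i\<close> over
    \<open>p \<le> i < p + q\<close>.\<close>
  have blocks: "norm (\<Sum>j\<in>J. F' j k) \<le> 2 * (1/2) ^ p - 2 * (1/2) ^ (p + q)"
    if "J \<subseteq> {N p..<N (p + q)}" for J p q k
    using that
  proof (induction q arbitrary: J)
    case (Suc q)
    define A where "A = J \<inter> {..<N (p + q)}"
    define B where "B = J \<inter> {N (p + q)..}"
    have "finite J" using finite_subset[OF Suc.prems] by simp
    then have "(\<Sum>j\<in>J. F' j k) = (\<Sum>j\<in>A. F' j k) + (\<Sum>j\<in>B. F' j k)"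
      by (subst sum.union_disjoint[symmetric]) (auto simp: A_def B_def intro!: sum.cong)
    moreover have "norm (\<Sum>j\<in>A. F' j k) \<le> 2 * (1/2) ^ p - 2 * (1/2) ^ (p + q)"
      using Suc.prems by (intro Suc.IH) (auto simp: A_def)
    moreover have "norm (\<Sum>j\<in>B. F' j k) \<le> (1/2) ^ (p + q)"
      using Suc.prems by (intro block) (auto simp: B_def)
    ultimately have "norm (\<Sum>j\<in>J. F' j k) \<le> 2 * (1/2) ^ p - 2 * (1/2) ^ (p + q) + (1/2) ^ (p + q)"
      using norm_triangle_mono by metis
    then show ?case by simp
  qed simp
  have tail: "norm (\<Sum>j\<in>J. F' j k) \<le> 2 * (1/2) ^ p" if J: "finite J" "J \<subseteq> {N p..}" for J p k
  proof -
    obtain q where "J \<subseteq> {..<q}" using J(1) finite_nat_iff_bounded by blast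
    moreover have "q \<le> N (p + q)" using strict_mono_imp_increasing[OF N, of "p + q"] by simp
    ultimately have "J \<subseteq> {N p..<N (p + q)}" using J(2) by fastforce
    from blocks[OF this, of k] show ?thesis by (rule order_trans) simp
  qed
  have diff: "norm ((\<Sum>j\<in>G. F' j k) - (\<Sum>j<N p. F' j k)) \<le> 2 * (1/2) ^ p"
    if G: "finite G" "{..<N p} \<subseteq> G" for G p k
  proof -
    have "(\<Sum>j\<in>G. F' j k) = (\<Sum>j\<in>G - {..<N p}. F' j k) + (\<Sum>j<N p. F' j k)"
      using G by (rule sum.subset_diff[rotated])
    then have "(\<Sum>j\<in>G. F' j k) - (\<Sum>j<N p. F' j k) = (\<Sum>j\<in>G - {..<N p}. F' j k)" by simp
    then show ?thesis using G tail[of "G - {..<N p}" p k] by (simp add: subset_eq)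
  qed
  have small: "\<exists>p. 4 * (1/2) ^ p < e" if e: "e > 0" for e :: real
  proof -
    obtain p where "(1/2) ^ p < e / 4" using real_arch_pow_inv[of "e / 4" "1/2"] e by auto
    then show ?thesis by (intro exI[of _ p]) simp
  qed
  have "\<exists>s. (\<lambda>n. \<Sum>j<n. F' j k) \<longlonglongrightarrow> s" for k
  proof -
    have "Cauchy (\<lambda>n. \<Sum>j<n. F' j k)"
    proof (rule metric_CauchyI)
      fix e :: real assume "e > 0"
      then obtain p where p: "4 * (1/2) ^ p < e" using small by blast
      have "dist (\<Sum>j<a. F' j k) (\<Sum>j<b. F' j k) < e" if "a \<ge> N p" "b \<ge> N p" for a b
      proof -
        have "dist (\<Sum>j<a. F' j k) (\<Sum>j<b. F' j k)
          \<le> dist (\<Sum>j<a. F' j k) (\<Sum>j<N p. F' j k) + dist (\<Sum>j<b. F' j k) (\<Sum>j<N p. F' j k)"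
          by (rule dist_triangle2)
        also have "\<dots> \<le> 2 * (1/2) ^ p + 2 * (1/2) ^ p"
          unfolding dist_norm using that by (intro add_mono diff) auto
        finally show ?thesis using p by simp
      qed
      then show "\<exists>M. \<forall>a\<ge>M. \<forall>b\<ge>M. dist (\<Sum>j<a. F' j k) (\<Sum>j<b. F' j k) < e" by blast
    qed
    then show ?thesis using Cauchy_convergent_iff convergent_def by blast
  qed
  then obtain S where S: "\<And>k. (\<lambda>n. \<Sum>j<n. F' j k) \<longlonglongrightarrow> S k" by metis
  have "unif_uncond_sum F' S"
    unfolding unif_uncond_sum_def
  proof (intro allI impI)
    fix e :: real assume "e > 0"
    then obtain p where p: "4 * (1/2) ^ p < e" using small by blast
    have lim: "norm (S k - (\<Sum>j<N p. F' j k)) \<le> 2 * (1/2) ^ p" for k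
    proof (rule Lim_norm_ubound[OF sequentially_bot])
      show "(\<lambda>n. (\<Sum>j<n. F' j k) - (\<Sum>j<N p. F' j k)) \<longlonglongrightarrow> S k - (\<Sum>j<N p. F' j k)"
        by (intro tendsto_intros S)
      show "\<forall>\<^sub>F n in sequentially. norm ((\<Sum>j<n. F' j k) - (\<Sum>j<N p. F' j k)) \<le> 2 * (1/2) ^ p"
        using eventually_ge_at_top[of "N p"] by eventually_elim (intro diff, auto)
    qed
    have "norm ((\<Sum>j\<in>G. F' j k) - S k) < e" if "finite G" "{..<N p} \<subseteq> G" for G k
      using dist_triangle2[of "\<Sum>j\<in>G. F' j k" "S k" "\<Sum>j<N p. F' j k"] diff[OF that, of k] lim[of k] p
      by (simp add: dist_norm)
    then show "\<exists>F0. finite F0 \<and> (\<forall>G. finite G \<longrightarrow> F0 \<subseteq> G \<longrightarrow> (\<forall>k. norm ((\<Sum>j\<in>G. F' j k) - S k) < e))"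
      by (intro exI[of _ "{..<N p}"]) auto
  qed
  then show ?thesis unfolding F'_def by blast
qed

section \<open>Decoupling forced by the dislocation group axioms\<close>

text \<open>A competitor \<open>y\<close> for \<open>inv (h k) (z k)\<close> corresponds under the
  isometry to the competitor \<open>h k y\<close> for \<open>z k\<close>, and strong convergence
  replaces this by the fixed vector \<open>H y\<close>.\<close>

lemma delta_null_strong_inverse:
  assumes z: "delta_conv z 0" and h: "\<And>k. bij_linear_isometry (h k)" "op_strong_conv h H"
  shows "delta_conv (\<lambda>k. inv (h k) (z k)) 0"
  unfolding delta_conv_iff
proof (intro allI impI)
  fix y and e :: real assume e: "e > 0"
  have "\<forall>\<^sub>F k in sequentially. dist (h k y) (H y) < e / 2"
    using h(2) e unfolding op_strong_conv_def by (intro tendstoD) auto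
  moreover have "\<forall>\<^sub>F k in sequentially. norm (z k - 0) \<le> norm (z k - H y) + e / 2"
    using e by (intro delta_convD[OF z]) simp
  ultimately show "\<forall>\<^sub>F k in sequentially. norm (inv (h k) (z k) - 0) \<le> norm (inv (h k) (z k) - y) + e"
  proof eventually_elim
    fix k assume k: "dist (h k y) (H y) < e / 2" "norm (z k - 0) \<le> norm (z k - H y) + e / 2"
    have "norm (inv (h k) (z k) - y) = norm (h k (inv (h k) (z k) - y))"
      by (simp only: bij_linear_isometryD(3)[OF h(1)])
    also have "\<dots> = norm (z k - h k y)"
      by (simp add: linear_diff[OF bij_linear_isometryD(1)[OF h(1)]] bij_linear_isometryD(5)[OF h(1)])
    finally show "norm (inv (h k) (z k) - 0) \<le> norm (inv (h k) (z k) - y) + e"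
      using k norm_triangle_ineq[of "z k - h k y" "h k y - H y"] bij_linear_isometryD(6)[OF h(1), of k "z k"]
      by (simp add: dist_norm)
  qed
qed

lemma dislocation_groupD:
  assumes "dislocation_group D0"
  shows "g \<in> D0 \<Longrightarrow> bij_linear_isometry g" "g \<in> D0 \<Longrightarrow> h \<in> D0 \<Longrightarrow> g \<circ> h \<in> D0"
    "g \<in> D0 \<Longrightarrow> inv g \<in> D0"
  using assms by (auto simp: dislocation_group_def)

lemma dislocation_group_extract:
  assumes "dislocation_group D0" "range gs \<subseteq> D0" "\<not> op_weak_conv gs (\<lambda>_. 0)"
  shows "\<exists>s g h. strict_mono s \<and> op_strong_conv (\<lambda>j. gs (s j)) g \<and> op_strong_conv (\<lambda>j. inv (gs (s j))) h"
  using assms unfolding dislocation_group_def by blast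

lemma dislocation_group_add:
  assumes "dislocation_group D0" "delta_conv z 0" "range gs \<subseteq> D0" "op_weak_conv gs (\<lambda>_. 0)"
  shows "delta_conv (\<lambda>k. z k + gs k y) 0"
  using assms unfolding dislocation_group_def by blast

text \<open>If \<open>inv (a k) \<circ> b k\<close> converged strongly along a subsequence, nullity
  would pass from \<open>inv (a k) (v k)\<close> to \<open>inv (b k) (v k)\<close>, contradicting
  \<open>p \<noteq> 0\<close> by uniqueness. The extraction axiom gives strong convergence of the
  operators and of their inverses; the second claim uses the inverses.\<close>

lemma distinct_profiles_decoupled:
  fixes v :: "nat \<Rightarrow> 'a::banach"
  assumes uc: "uniformly_convex TYPE('a)" and D0: "dislocation_group D0"
    and a: "range a \<subseteq> D0" and b: "range b \<subseteq> D0" and v: "bounded (range v)"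
    and null: "delta_conv (\<lambda>k. inv (a k) (v k)) 0" and p: "delta_conv (\<lambda>k. inv (b k) (v k)) p" "p \<noteq> 0"
  shows "op_weak_conv (\<lambda>k. inv (a k) \<circ> b k) (\<lambda>_. 0)" "op_weak_conv (\<lambda>k. inv (b k) \<circ> a k) (\<lambda>_. 0)"
proof -
  have aD: "a k \<in> D0" and bD: "b k \<in> D0" for k using a b by auto
  note isoa = bij_linear_isometryD[OF dislocation_groupD(1)[OF D0 aD]]
  note isob = bij_linear_isometryD[OF dislocation_groupD(1)[OF D0 bD]]
  have cD: "inv (a k) \<circ> b k \<in> D0" "inv (b k) \<circ> a k \<in> D0" for k
    using dislocation_groupD[OF D0] aD bD by blast+
  note isoc = bij_linear_isometryD[OF dislocation_groupD(1)[OF D0 cD(1)]]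
  have inv_c: "inv (inv (a k) \<circ> b k) = inv (b k) \<circ> a k" "inv (inv (b k) \<circ> a k) = inv (a k) \<circ> b k" for k
    using isoa(2) isob(2) by (simp_all add: o_inv_distrib bij_imp_bij_inv inv_inv_eq)
  have no: "\<not> op_strong_conv (\<lambda>j. inv (a (s j)) \<circ> b (s j)) H" if s: "strict_mono s" for s :: "nat \<Rightarrow> nat" and H
  proof
    assume H: "op_strong_conv (\<lambda>j. inv (a (s j)) \<circ> b (s j)) H"
    have "delta_conv (\<lambda>j. inv (inv (a (s j)) \<circ> b (s j)) (inv (a (s j)) (v (s j)))) 0"
      using delta_null_strong_inverse[OF delta_conv_subseq[OF null s] dislocation_groupD(1)[OF D0 cD(1)] H] .
    then have "delta_conv (\<lambda>j. inv (b (s j)) (v (s j))) 0"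
      by (simp add: inv_c isoa(5))
    moreover have "delta_conv (\<lambda>j. inv (b (s j)) (v (s j))) p"
      by (rule delta_conv_subseq[OF p(1) s])
    moreover have "bounded (range (\<lambda>j. inv (b (s j)) (v (s j))))"
      using v unfolding bounded_iff by (auto simp: isob(6))
    ultimately show False using delta_conv_unique[OF uc] p(2) by blast
  qed
  show "op_weak_conv (\<lambda>k. inv (a k) \<circ> b k) (\<lambda>_. 0)"
  proof (rule ccontr)
    assume "\<not> op_weak_conv (\<lambda>k. inv (a k) \<circ> b k) (\<lambda>_. 0)"
    from dislocation_group_extract[OF D0 _ this] cD(1) no show False by blast
  qed
  show "op_weak_conv (\<lambda>k. inv (b k) \<circ> a k) (\<lambda>_. 0)"
  proof (rule ccontr)
    assume "\<not> op_weak_conv (\<lambda>k. inv (b k) \<circ> a k) (\<lambda>_. 0)"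
    from dislocation_group_extract[OF D0 _ this] cD(2)
    obtain s h where "strict_mono s" "op_strong_conv (\<lambda>j. inv (inv (b (s j)) \<circ> a (s j))) h" by blast
    then show False using no unfolding inv_c by blast
  qed
qed

section \<open>Remainders and their asymptotic norms\<close>

text \<open>The outcome of greedy extraction with the subsequence absorbed into \<open>u\<close>:
  \<open>V n\<close> is the remainder after removing \<open>n\<close> profiles and
  \<open>\<rho> n\<close> its asymptotic norm. Profiles may vanish, and nothing decouples the
  dislocations of a zero profile.\<close>

locale profile_extraction =
  fixes D0 D :: "('a::banach \<Rightarrow> 'a) set" and u :: "nat \<Rightarrow> 'a"
    and g :: "nat \<Rightarrow> nat \<Rightarrow> 'a \<Rightarrow> 'a" and w :: "nat \<Rightarrow> 'a" and \<rho> :: "nat \<Rightarrow> real"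
    and V :: "nat \<Rightarrow> nat \<Rightarrow> 'a"
  assumes uc: "uniformly_convex TYPE('a)"
    and D0: "dislocation_group D0" and D: "D \<subseteq> D0" and u: "bounded (range u)"
    and gD: "\<And>n k. g n k \<in> D"
    and V_eq: "\<And>n k. V n k = u k - (\<Sum>j<n. g j k (w j))"
    and profile: "\<And>n. delta_conv (\<lambda>k. inv (g n k) (V n k)) (w n)"
    and limit: "\<And>n. (\<lambda>k. norm (V n k)) \<longlonglongrightarrow> \<rho> n"
    and maximal: "\<And>n (t :: nat \<Rightarrow> nat) h p. strict_mono t \<Longrightarrow> range h \<subseteq> D \<Longrightarrow>
      delta_conv (\<lambda>i. inv (h i) (V (Suc n) (t i))) p \<Longrightarrow> norm p \<le> 2 * norm (w (Suc n))"
begin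

lemmas iso_D0 = bij_linear_isometryD[OF dislocation_groupD(1)[OF D0]]
lemmas iso_D = iso_D0[OF subsetD[OF D]]
lemmas iso_g = iso_D[OF gD]

lemma g_D0: "g n k \<in> D0"
  using gD D by blast

lemma V_Suc: "V (Suc n) k = V n k - g n k (w n)"
  by (simp add: V_eq)

lemma V_split: "m \<le> n \<Longrightarrow> V m k = V n k + (\<Sum>j\<in>{m..<n}. g j k (w j))"
  unfolding V_eq lessThan_atLeast0
  using sum.atLeastLessThan_concat[of 0 m n "\<lambda>j. g j k (w j)"] by (simp add: algebra_simps)

lemma bounded_V: "bounded (range (V n))"
proof -
  obtain M where M: "\<And>k. norm (u k) \<le> M" using u unfolding bounded_iff by auto
  have "norm (V n k) \<le> M + (\<Sum>j<n. norm (w j))" for k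
  proof -
    have "norm (V n k) \<le> norm (u k) + norm (\<Sum>j<n. g j k (w j))"
      unfolding V_eq by (rule norm_triangle_ineq4)
    also have "norm (\<Sum>j<n. g j k (w j)) \<le> (\<Sum>j<n. norm (w j))"
      using norm_sum[of "\<lambda>j. g j k (w j)" "{..<n}"] by (simp add: iso_g(3))
    finally show ?thesis using M[of k] by simp
  qed
  then show ?thesis unfolding bounded_iff by blast
qed

text \<open>The two halves feed each other: nullity of \<open>V n\<close> in the frame of
  \<open>g j\<close> decouples the new profile \<open>n\<close> from \<open>j\<close>, and this
  decoupling lets the additivity axiom preserve nullity when profile \<open>n\<close> is
  subtracted.\<close>

lemma null_and_decoupled:
  "(\<forall>j<n. w j \<noteq> 0 \<longrightarrow> delta_conv (\<lambda>k. inv (g j k) (V n k)) 0) \<and>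
   (\<forall>i<n. \<forall>j<n. i \<noteq> j \<longrightarrow> w i \<noteq> 0 \<longrightarrow> w j \<noteq> 0 \<longrightarrow> op_weak_conv (\<lambda>k. inv (g i k) \<circ> g j k) (\<lambda>_. 0))"
proof (induction n)
  case (Suc n)
  have dec: "op_weak_conv (\<lambda>k. inv (g j k) \<circ> g n k) (\<lambda>_. 0)" "op_weak_conv (\<lambda>k. inv (g n k) \<circ> g j k) (\<lambda>_. 0)"
    if "j < n" "w j \<noteq> 0" "w n \<noteq> 0" for j
    using distinct_profiles_decoupled[OF uc D0 _ _ bounded_V _ profile that(3), of "g j"] Suc.IH that g_D0
    by blast+
  have "delta_conv (\<lambda>k. inv (g j k) (V (Suc n) k)) 0" if j: "j < Suc n" "w j \<noteq> 0" for j
  proof (cases "j = n")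
    case True
    have "inv (g n k) (V (Suc n) k) = inv (g n k) (V n k) - w n" for k
      by (simp add: V_Suc linear_diff[OF iso_g(7)] iso_g(4))
    then show ?thesis using delta_conv_diff_const[OF profile[of n]] True by simp
  next
    case False
    then have jn: "j < n" using j by simp
    then have null: "delta_conv (\<lambda>k. inv (g j k) (V n k)) 0" using Suc.IH j by blast
    show ?thesis
    proof (cases "w n = 0")
      case True
      then show ?thesis using null by (simp add: V_Suc linear_0[OF iso_g(1)])
    next
      case False
      have "range (\<lambda>k. inv (g j k) \<circ> g n k) \<subseteq> D0"
        using dislocation_groupD[OF D0] g_D0 by blast
      from dislocation_group_add[OF D0 null this dec(1)[OF jn j(2) False], of "- w n"]
      show ?thesis
        by (simp add: V_Suc linear_diff[OF iso_g(7)] linear_neg[OF iso_g(1)] linear_neg[OF iso_g(7)])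
    qed
  qed
  moreover have "op_weak_conv (\<lambda>k. inv (g i k) \<circ> g j k) (\<lambda>_. 0)"
    if "i < Suc n" "j < Suc n" "i \<noteq> j" "w i \<noteq> 0" "w j \<noteq> 0" for i j
    using that Suc.IH dec unfolding less_Suc_eq by blast
  ultimately show ?case by blast
qed simp

lemma decoupled: "i \<noteq> j \<Longrightarrow> w i \<noteq> 0 \<Longrightarrow> w j \<noteq> 0 \<Longrightarrow> op_weak_conv (\<lambda>k. inv (g i k) \<circ> g j k) (\<lambda>_. 0)"
  using null_and_decoupled[of "Suc (max i j)"] by simp

text \<open>In the frame of \<open>g i\<close> the other profiles are moved off weakly to 0, so the
  additivity axiom permits restoring any multiples of them; the coefficient is absorbed into the
  vector.\<close>

lemma null_partial_sum:
  assumes i: "i < n" "w i \<noteq> 0" and A: "finite A" "i \<notin> A"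
  shows "delta_conv (\<lambda>k. inv (g i k) (V n k + (\<Sum>j\<in>A. c j *\<^sub>R g j k (w j)))) 0"
  using A
proof (induction A rule: finite_induct)
  case empty
  then show ?case using null_and_decoupled[of n] i by simp
next
  case (insert j A)
  show ?case
  proof (cases "w j = 0")
    case True
    then show ?thesis using insert by (simp add: linear_0[OF iso_g(1)])
  next
    case False
    have "delta_conv (\<lambda>k. inv (g i k) (V n k + (\<Sum>j\<in>A. c j *\<^sub>R g j k (w j))) +
        (inv (g i k) \<circ> g j k) (c j *\<^sub>R w j)) 0"
    proof (rule dislocation_group_add[OF D0])
      show "range (\<lambda>k. inv (g i k) \<circ> g j k) \<subseteq> D0"
        using dislocation_groupD[OF D0] g_D0 by blast
      show "op_weak_conv (\<lambda>k. inv (g i k) \<circ> g j k) (\<lambda>_. 0)"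
        using insert i False by (intro decoupled) auto
    qed (use insert in auto)
    moreover have "inv (g i k) (V n k + (\<Sum>j\<in>A. c j *\<^sub>R g j k (w j))) +
        (inv (g i k) \<circ> g j k) (c j *\<^sub>R w j) =
        inv (g i k) (V n k + (\<Sum>j\<in>insert j A. c j *\<^sub>R g j k (w j)))" for k
      using insert by (simp add: linear_add[OF iso_g(7)] linear_scale[OF iso_g(1)] algebra_simps)
    ultimately show ?thesis by simp
  qed
qed

text \<open>Terms are restored one at a time. In the frame of \<open>g i\<close> the current sum is
  \<Delta>-null, so comparing its limit 0 with the competitor \<open>- (c i *\<^sub>R w i)\<close>
  shows that restoring term \<open>i\<close> does not lower the norm asymptotically.\<close>

lemma norm_partial_sum_mono:
  assumes AB: "A \<subseteq> B" "B \<subseteq> {..<n}" and e: "e > 0"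
  shows "\<forall>\<^sub>F k in sequentially. norm (V n k + (\<Sum>j\<in>A. c j *\<^sub>R g j k (w j)))
    \<le> norm (V n k + (\<Sum>j\<in>B. c j *\<^sub>R g j k (w j))) + e"
proof -
  have fin: "finite B" using finite_subset[OF AB(2)] by simp
  with AB(1) have "finite A" by (rule finite_subset)
  note fin = fin this
  have "\<forall>\<^sub>F k in sequentially. norm (V n k + (\<Sum>j\<in>A. c j *\<^sub>R g j k (w j)))
    \<le> norm (V n k + (\<Sum>j\<in>A \<union> C. c j *\<^sub>R g j k (w j))) + e"
    if "finite C" "C \<subseteq> {..<n} - A" "e > 0" for C e
    using that
  proof (induction C arbitrary: e rule: finite_induct)
    case (insert i C)
    define T where "T k = V n k + (\<Sum>j\<in>A \<union> C. c j *\<^sub>R g j k (w j))" for k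
    have e: "e / 2 > 0" using insert.prems by simp
    have C: "finite C" "C \<subseteq> {..<n} - A" using insert.hyps insert.prems by auto
    have i: "i < n" "i \<notin> A \<union> C" using insert.hyps insert.prems by auto
    have ins: "V n k + (\<Sum>j\<in>A \<union> insert i C. c j *\<^sub>R g j k (w j)) = T k + c i *\<^sub>R g i k (w i)" for k
      using i fin C by (simp add: T_def algebra_simps)
    have "\<forall>\<^sub>F k in sequentially. norm (T k) \<le> norm (T k + c i *\<^sub>R g i k (w i)) + e / 2"
    proof (cases "w i = 0")
      case True
      then show ?thesis using e by (simp add: linear_0[OF iso_g(1)])
    next
      case False
      have "delta_conv (\<lambda>k. inv (g i k) (T k)) 0"
        unfolding T_def using i False fin C by (intro null_partial_sum) auto
      from delta_convD[OF this e, of "- (c i *\<^sub>R w i)"]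
      have "\<forall>\<^sub>F k in sequentially. norm (inv (g i k) (T k)) \<le> norm (inv (g i k) (T k) + c i *\<^sub>R w i) + e / 2"
        by simp
      moreover have "norm (inv (g i k) (T k) + c i *\<^sub>R w i) = norm (T k + c i *\<^sub>R g i k (w i))" for k
      proof -
        have "g i k (inv (g i k) (T k) + c i *\<^sub>R w i) = T k + c i *\<^sub>R g i k (w i)"
          by (simp add: linear_add[OF iso_g(1)] linear_scale[OF iso_g(1)] iso_g(5))
        then show ?thesis using iso_g(3)[of i k "inv (g i k) (T k) + c i *\<^sub>R w i"] by simp
      qed
      ultimately show ?thesis by (simp add: iso_g(6))
    qed
    moreover have "\<forall>\<^sub>F k in sequentially. norm (V n k + (\<Sum>j\<in>A. c j *\<^sub>R g j k (w j))) \<le> norm (T k) + e / 2"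
      unfolding T_def using C(2) e by (rule insert.IH)
    ultimately show ?case
      unfolding ins by eventually_elim simp
  qed simp_all
  from this[OF _ _ e, of "B - A"] have "\<forall>\<^sub>F k in sequentially. norm (V n k + (\<Sum>j\<in>A. c j *\<^sub>R g j k (w j)))
    \<le> norm (V n k + (\<Sum>j\<in>A \<union> (B - A). c j *\<^sub>R g j k (w j))) + e"
    using AB fin by (simp only: finite_Diff Diff_mono subset_refl)
  moreover have "A \<union> (B - A) = B" using AB by auto
  ultimately show ?thesis by (simp only:)
qed

lemma limit_mono: "m \<le> n \<Longrightarrow> \<rho> n \<le> \<rho> m"
proof (rule field_le_epsilon)
  fix e :: real assume mn: "m \<le> n" and e: "e > 0"
  have "\<forall>\<^sub>F k in sequentially. norm (V n k) \<le> norm (V m k) + e"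
    using norm_partial_sum_mono[of "{}" "{m..<n}" n e "\<lambda>_. 1"] e
    by (simp add: V_split[OF mn] subset_eq)
  then show "\<rho> n \<le> \<rho> m + e"
    using tendsto_le[OF sequentially_bot tendsto_add[OF limit[of m] tendsto_const[of e]] limit[of n]]
    by simp
qed

lemma limit_nonneg: "0 \<le> \<rho> n"
  by (rule tendsto_lowerbound[OF limit]) auto

text \<open>The remainders before and after removing the profiles in \<open>J\<close>, and their midpoint, all have
  asymptotic norm between \<open>\<rho> n\<close> and \<open>\<rho> m\<close>.\<close>
lemma small_gap_small_sum:
  assumes e: "e > 0"
  shows "\<exists>\<eta>>0. \<forall>m n J. m \<le> n \<longrightarrow> J \<subseteq> {m..<n} \<longrightarrow> \<rho> m - \<rho> n < \<eta> \<longrightarrow>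
    (\<forall>\<^sub>F k in sequentially. norm (\<Sum>j\<in>J. g j k (w j)) < e)"
proof -
  obtain \<eta> where \<eta>: "\<eta> > 0" and mid:
    "\<And>(a::'a) b R. norm a \<le> R \<Longrightarrow> norm b \<le> R \<Longrightarrow> R \<le> \<rho> 0 + 2 \<Longrightarrow> e \<le> norm (a - b) \<Longrightarrow>
       norm ((a + b) /\<^sub>R 2) \<le> R - \<eta>"
    using uniformly_convex_scaled[OF uc e, of "\<rho> 0 + 2"] by blast
  \<comment> \<open>Four errors are spent: two in \<open>R\<close>, one in the lower bound for
    \<open>V n\<close>, one in its comparison with the midpoint. The gap and these errors may each
    use \<open>\<eta> / 2\<close>.\<close>
  define \<epsilon> where "\<epsilon> = min 1 (\<eta> / 8)"
  have \<epsilon>: "0 < \<epsilon>" "\<epsilon> \<le> 1" "4 * \<epsilon> \<le> \<eta> / 2" using \<eta> by (auto simp: \<epsilon>_def)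
  have "\<forall>\<^sub>F k in sequentially. norm (\<Sum>j\<in>J. g j k (w j)) < e"
    if mn: "m \<le> n" and J: "J \<subseteq> {m..<n}" and gap: "\<rho> m - \<rho> n < \<eta> / 2" for m n J
  proof -
    \<comment> \<open>Weight 1/2 on \<open>J\<close> gives the midpoint of \<open>V m\<close> and
      \<open>V m\<close> with the block removed.\<close>
    define c where "c j = (if j \<in> J then 1/2 else 1 :: real)" for j
    define R where "R = \<rho> m + 2 * \<epsilon>"
    have I: "{m..<n} \<subseteq> {..<n}" by auto
    have RM: "R \<le> \<rho> 0 + 2" using limit_mono[of 0 m] \<epsilon> by (simp add: R_def)
    have split: "(\<Sum>j\<in>{m..<n}. h j) = (\<Sum>j\<in>{m..<n} - J. h j) + (\<Sum>j\<in>J. h j)" for h :: "nat \<Rightarrow> 'a"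
      using J by (intro sum.subset_diff) auto
    have b_eq: "V n k + (\<Sum>j\<in>{m..<n} - J. g j k (w j)) = V m k - (\<Sum>j\<in>J. g j k (w j))" for k
      unfolding V_split[OF mn] split by simp
    have m_eq: "V n k + (\<Sum>j\<in>{m..<n}. c j *\<^sub>R g j k (w j)) =
        (V m k + (V m k - (\<Sum>j\<in>J. g j k (w j)))) /\<^sub>R 2" for k
    proof -
      have "(\<Sum>j\<in>{m..<n} - J. c j *\<^sub>R g j k (w j)) = (\<Sum>j\<in>{m..<n} - J. g j k (w j))"
        by (intro sum.cong) (auto simp: c_def)
      moreover have "(\<Sum>j\<in>J. c j *\<^sub>R g j k (w j)) = (\<Sum>j\<in>J. g j k (w j)) /\<^sub>R 2"
        unfolding scaleR_sum_right by (intro sum.cong) (auto simp: c_def)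
      ultimately have "V n k + (\<Sum>j\<in>{m..<n}. c j *\<^sub>R g j k (w j)) =
          V m k - (\<Sum>j\<in>J. g j k (w j)) + (\<Sum>j\<in>J. g j k (w j)) /\<^sub>R 2"
        unfolding split b_eq[symmetric] by simp
      also have "\<dots> = V m k - (0 + (\<Sum>j\<in>J. g j k (w j))) /\<^sub>R 2"
        using scaleR_half_double[of "\<Sum>j\<in>J. g j k (w j)"] by (simp add: algebra_simps)
      finally show ?thesis using midpoint_diff[of "V m k" 0 "\<Sum>j\<in>J. g j k (w j)"] by simp
    qed
    have "\<forall>\<^sub>F k in sequentially. norm (V m k) < \<rho> m + \<epsilon>"
      using order_tendstoD(2)[OF limit] \<epsilon> by simp
    moreover have "\<forall>\<^sub>F k in sequentially. norm (V n k) > \<rho> n - \<epsilon>"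
      using order_tendstoD(1)[OF limit] \<epsilon> by simp
    moreover have "\<forall>\<^sub>F k in sequentially. norm (V m k - (\<Sum>j\<in>J. g j k (w j))) \<le> norm (V m k) + \<epsilon>"
      using norm_partial_sum_mono[OF _ I \<epsilon>(1), of "{m..<n} - J" "\<lambda>_. 1"]
      by (simp add: b_eq V_split[OF mn, symmetric])
    moreover have "\<forall>\<^sub>F k in sequentially. norm (V n k) \<le>
        norm ((V m k + (V m k - (\<Sum>j\<in>J. g j k (w j)))) /\<^sub>R 2) + \<epsilon>"
      using norm_partial_sum_mono[OF _ I \<epsilon>(1), of "{}" c] unfolding m_eq by simp
    ultimately show ?thesis
    proof eventually_elim
      case (elim k)
      show ?case
      proof (rule ccontr)
        assume "\<not> norm (\<Sum>j\<in>J. g j k (w j)) < e"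
        then have "norm ((V m k + (V m k - (\<Sum>j\<in>J. g j k (w j)))) /\<^sub>R 2) \<le> R - \<eta>"
          using elim \<epsilon> RM by (intro mid) (auto simp: R_def)
        then have "\<eta> < \<rho> m - \<rho> n + 4 * \<epsilon>" using elim(2,4) unfolding R_def by linarith
        then show False using gap \<epsilon>(3) by linarith
      qed
    qed
  qed
  moreover have "\<eta> / 2 > 0" using \<eta> by simp
  ultimately show ?thesis by blast
qed

lemma limit_gap_tendsto_0:
  assumes "\<eta> > 0"
  shows "\<exists>m. \<forall>n\<ge>m. \<rho> m - \<rho> n < \<eta>"
proof -
  have "decseq \<rho>" unfolding decseq_def using limit_mono by blast
  then obtain L where L: "\<rho> \<longlonglongrightarrow> L" "\<And>i. L \<le> \<rho> i"
    using decseq_convergent[of \<rho> 0] limit_nonneg by blast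
  have "\<forall>\<^sub>F m in sequentially. \<rho> m < L + \<eta>"
    using order_tendstoD(2)[OF L(1)] assms by simp
  then obtain m where "\<rho> m < L + \<eta>" by (auto dest: eventually_happens)
  then have "\<rho> m - \<rho> n < \<eta>" for n using L(2)[of n] by simp
  then show ?thesis by blast
qed

lemma small_tails:
  assumes e: "e > 0"
  shows "\<exists>m. \<forall>J. finite J \<longrightarrow> J \<subseteq> {m..} \<longrightarrow> (\<forall>\<^sub>F k in sequentially. norm (\<Sum>j\<in>J. g j k (w j)) < e)"
proof -
  obtain \<eta> where \<eta>: "\<eta> > 0" "\<And>m n J. m \<le> n \<Longrightarrow> J \<subseteq> {m..<n} \<Longrightarrow> \<rho> m - \<rho> n < \<eta> \<Longrightarrow>
    \<forall>\<^sub>F k in sequentially. norm (\<Sum>j\<in>J. g j k (w j)) < e"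
    using small_gap_small_sum[OF e] by blast
  obtain m where m: "\<And>n. n \<ge> m \<Longrightarrow> \<rho> m - \<rho> n < \<eta>" using limit_gap_tendsto_0[OF \<eta>(1)] by blast
  have "\<forall>\<^sub>F k in sequentially. norm (\<Sum>j\<in>J. g j k (w j)) < e" if J: "finite J" "J \<subseteq> {m..}" for J
  proof -
    obtain n where "J \<subseteq> {..<n}" using J(1) finite_nat_iff_bounded by blast
    then have "J \<subseteq> {m..<max m n}" using J(2) by fastforce
    then show ?thesis using m[of "max m n"] by (intro \<eta>(2)[of m "max m n"]) auto
  qed
  then show ?thesis by blast
qed

lemma profiles_small: "e > 0 \<Longrightarrow> \<exists>m. \<forall>n\<ge>m. norm (w n) < e"
proof -
  assume "e > 0"
  from small_tails[OF this] obtain m where m: "\<And>J. finite J \<Longrightarrow> J \<subseteq> {m..} \<Longrightarrow>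
    \<forall>\<^sub>F k in sequentially. norm (\<Sum>j\<in>J. g j k (w j)) < e" by blast
  have "norm (w n) < e" if "n \<ge> m" for n
    using m[of "{n}"] that by (simp add: iso_g(3))
  then show ?thesis by blast
qed

text \<open>The block \<open>{n}\<close> has a sum of constant norm \<open>norm (w n)\<close>, so
  the gap cannot be small. Strictness is what later puts remainders inside the unit ball.\<close>

lemma limit_strict_decrease:
  assumes "w n \<noteq> 0"
  shows "\<rho> (Suc n) < \<rho> n"
proof -
  have "norm (w n) > 0" using assms by simp
  from small_gap_small_sum[OF this] obtain \<eta> where "\<eta> > 0" and
    \<eta>: "\<forall>m n' J. m \<le> n' \<longrightarrow> J \<subseteq> {m..<n'} \<longrightarrow> \<rho> m - \<rho> n' < \<eta> \<longrightarrow>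
      (\<forall>\<^sub>F k in sequentially. norm (\<Sum>j\<in>J. g j k (w j)) < norm (w n))"
    by (elim exE conjE)
  have "\<not> \<rho> n - \<rho> (Suc n) < \<eta>"
    using \<eta>[THEN spec, of n, THEN spec, of "Suc n", THEN spec, of "{n}"] by (simp add: iso_g(3))
  then show ?thesis using \<open>\<eta> > 0\<close> by simp
qed

text \<open>\<open>modulus_convexity_ball\<close> is applied to \<open>V n k\<close> and
  \<open>V (Suc n) k\<close>, whose difference has norm \<open>norm (w n)\<close>; removing the
  profile, fully or by half, cannot raise the norm asymptotically, and the half-step stays above
  \<open>\<rho> (Suc n)\<close>.\<close>

lemma energy_step:
  assumes u1: "\<And>k. norm (u k) \<le> 1"
  shows "\<rho> (Suc n) + modulus_convexity TYPE('a) (norm (w n)) \<le> \<rho> n"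
proof (cases "w n = 0")
  case True
  have "modulus_convexity TYPE('a) 0 \<le> 0" using modulus_convexity_ball[OF uc, of 0 0 0] by simp
  then show ?thesis using True limit_mono[of n "Suc n"] by simp
next
  case False
  have "\<rho> 0 \<le> 1"
    using u1 by (intro tendsto_upperbound[OF limit[of 0]]) (auto simp: V_eq)
  then have \<rho>1: "\<rho> m \<le> 1" for m using limit_mono[of 0 m] by simp
  \<comment> \<open>The ball estimate needs radius at most 1 exactly. When
    \<open>\<rho> n = 1\<close> the limit alone does not give this, but strict decrease then leaves
    no nonzero profile before \<open>n\<close>, so \<open>V n k = u k\<close>.\<close>
  have "\<forall>\<^sub>F k in sequentially. norm (V n k) \<le> 1"
  proof (cases "\<rho> n < 1")
    case True
    from order_tendstoD(2)[OF limit this] show ?thesis by (rule eventually_mono) simp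
  next
    case no_decrease: False
    have "w j = 0" if "j < n" for j
      using limit_strict_decrease[of j] limit_mono[of "Suc j" n] that \<rho>1[of j] no_decrease by fastforce
    then have "V n k = u k" for k by (simp add: V_eq linear_0[OF iso_g(1)])
    then show ?thesis using u1 by simp
  qed
  moreover have "\<forall>\<^sub>F k in sequentially. norm (V (Suc n) k) < 1"
    using limit_strict_decrease[OF False] \<rho>1[of n] by (intro order_tendstoD(2)[OF limit]) simp
  ultimately have le1: "\<forall>\<^sub>F k in sequentially. norm (V n k) \<le> 1 \<and> norm (V (Suc n) k) < 1"
    by (rule eventually_conj)
  have mid: "V (Suc n) k + (1/2) *\<^sub>R g n k (w n) = (V n k + V (Suc n) k) /\<^sub>R 2" for k
    using scaleR_half_double[of "V (Suc n) k"] by (simp add: V_split[of n "Suc n"] algebra_simps)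
  show ?thesis
  proof (rule field_le_epsilon)
    fix e' :: real assume "e' > 0"
    define e where "e = e' / 4"
    have e: "e > 0" using \<open>e' > 0\<close> by (simp add: e_def)
    have "\<forall>\<^sub>F k in sequentially. norm (V (Suc n) k) \<le> norm (V n k) + e"
      using norm_partial_sum_mono[of "{}" "{n}" "Suc n" e "\<lambda>_. 1"] e by (simp add: V_Suc)
    moreover have "\<forall>\<^sub>F k in sequentially. norm (V (Suc n) k) \<le> norm ((V n k + V (Suc n) k) /\<^sub>R 2) + e"
      using norm_partial_sum_mono[of "{}" "{n}" "Suc n" e "\<lambda>_. 1/2"] e unfolding mid[symmetric] by simp
    moreover have "\<forall>\<^sub>F k in sequentially. norm (V n k) < \<rho> n + e"
      using order_tendstoD(2)[OF limit] e by simp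
    moreover have "\<forall>\<^sub>F k in sequentially. norm (V (Suc n) k) > \<rho> (Suc n) - e"
      using order_tendstoD(1)[OF limit] e by simp
    ultimately have "\<forall>\<^sub>F k in sequentially.
        \<rho> (Suc n) + modulus_convexity TYPE('a) (norm (w n)) \<le> \<rho> n + e'"
      using le1
    proof eventually_elim
      case (elim k)
      define R where "R = max (norm (V n k)) (norm (V (Suc n) k))"
      have "V n k - V (Suc n) k = g n k (w n)" by (simp add: V_Suc)
      then have nw: "norm (V n k - V (Suc n) k) = norm (w n)" by (simp only: iso_g(3))
      have "modulus_convexity TYPE('a) (norm (w n)) \<le> R - norm ((V n k + V (Suc n) k) /\<^sub>R 2)"
        unfolding nw[symmetric] using elim by (intro modulus_convexity_ball[OF uc]) (auto simp: R_def)
      moreover have "R \<le> norm (V n k) + e" using elim e by (simp add: R_def)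
      ultimately show ?case using elim(2,3,4) \<open>e' > 0\<close> unfolding e_def by linarith
    qed
    then show "\<rho> (Suc n) + modulus_convexity TYPE('a) (norm (w n)) \<le> \<rho> n + e'" by simp
  qed
qed

text \<open>Each moved profile is a difference of two consecutive remainders; for sequences in the
  unit ball this is the origin of the bound 2.\<close>

lemma norm_profile_le: "norm (w n) \<le> \<rho> n + \<rho> (Suc n)"
proof (rule tendsto_lowerbound)
  show "(\<lambda>k. norm (V n k) + norm (V (Suc n) k)) \<longlonglongrightarrow> \<rho> n + \<rho> (Suc n)"
    by (intro tendsto_intros limit)
  have "norm (w n) \<le> norm (V n k) + norm (V (Suc n) k)" for k
    using norm_triangle_ineq4[of "V n k" "V (Suc n) k"] by (simp add: V_Suc iso_g(3))
  then show "\<forall>\<^sub>F k in sequentially. norm (w n) \<le> norm (V n k) + norm (V (Suc n) k)" by simp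
qed simp

section \<open>The remainder of the full series\<close>

text \<open>A nonzero \<Delta>-limit \<open>p\<close> of \<open>inv (gs k) (r k)\<close> would, by
  stability, be close to a \<Delta>-limit \<open>q\<close> for some late \<open>V (Suc n)\<close>.
  But maximality bounds \<open>q\<close> by twice the small profile
  \<open>w (Suc n)\<close>.\<close>

lemma D_delta_null_remainder:
  assumes r: "bounded (range r)"
    and approx: "\<And>e. e > 0 \<Longrightarrow> \<exists>m. \<forall>n\<ge>m. \<forall>\<^sub>F k in sequentially. norm (r k - V n k) < e"
  shows "D_delta_null D r"
  unfolding D_delta_null_def
proof (intro allI impI, rule ccontr)
  fix gs :: "nat \<Rightarrow> 'a \<Rightarrow> 'a" assume gs: "range gs \<subseteq> D"
  then have gsD: "gs k \<in> D" for k by blast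
  assume not: "\<not> delta_conv (\<lambda>k. inv (gs k) (r k)) 0"
  obtain M where M: "\<And>k. norm (r k) \<le> M" using r unfolding bounded_iff by auto
  have "bounded (range (\<lambda>k. inv (gs k) (r k)))"
    unfolding bounded_iff using M by (auto simp: iso_D(6)[OF gsD])
  from not_delta_conv_subseq[OF uc this not] obtain t :: "nat \<Rightarrow> nat" and p
    where t: "strict_mono t" and p: "delta_conv (\<lambda>k. inv (gs (t k)) (r (t k))) p" "p \<noteq> 0" by blast
  have "norm p / 2 > 0" using p(2) by simp
  then obtain \<eta> where \<eta>: "\<eta> > 0" and stable:
    "\<And>a b (p'::'a) q. delta_conv a p' \<Longrightarrow> delta_conv b q \<Longrightarrow>
       \<forall>\<^sub>F k in sequentially. norm (a k - b k) \<le> \<eta> \<Longrightarrow>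
       \<forall>\<^sub>F k in sequentially. norm (a k) \<le> M \<Longrightarrow> norm (p' - q) < norm p / 2"
    using delta_limit_stable[OF uc, of "norm p / 2" M] by blast
  obtain m1 where m1: "\<And>n. n \<ge> m1 \<Longrightarrow> \<forall>\<^sub>F k in sequentially. norm (r k - V n k) < \<eta>"
    using approx[OF \<eta>] by blast
  \<comment> \<open>The quarter allows for the factor 2 in maximality: \<open>norm q\<close> and
    \<open>norm (p - q)\<close> then stay below half of \<open>norm p\<close>.\<close>
  obtain m2 where m2: "\<And>n. n \<ge> m2 \<Longrightarrow> norm (w n) < norm p / 4"
    using profiles_small[of "norm p / 4"] p(2) by auto
  define n where "n = max m1 m2"
  have "bounded (range (\<lambda>i. inv (gs (t i)) (V (Suc n) (t i))))"
    using bounded_V[of "Suc n"] unfolding bounded_iff by (auto simp: iso_D(6)[OF gsD])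
  from delta_compact[OF uc this] obtain t' q where t': "strict_mono t'"
    and q: "delta_conv (\<lambda>i. inv (gs (t (t' i))) (V (Suc n) (t (t' i)))) q" by blast
  have tt: "strict_mono (\<lambda>i. t (t' i))" using strict_mono_o[OF t t'] by (simp add: o_def)
  have "norm q \<le> 2 * norm (w (Suc n))"
    using maximal[OF tt _ q] gsD by blast
  then have q_small: "norm q < norm p / 2" using m2[of "Suc n"] le_SucI[OF max.cobounded2[of m2 m1]]
    by (simp add: n_def max.commute)
  have "norm (p - q) < norm p / 2"
  proof (rule stable[OF delta_conv_subseq[OF p(1) t'] q])
    have "\<forall>\<^sub>F k in sequentially. norm (r k - V (Suc n) k) < \<eta>" by (rule m1) (simp add: n_def)
    from eventually_subseq[OF tt this]
    show "\<forall>\<^sub>F k in sequentially. norm (inv (gs (t (t' k))) (r (t (t' k))) -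
        inv (gs (t (t' k))) (V (Suc n) (t (t' k)))) \<le> \<eta>"
      by (rule eventually_mono) (simp add: linear_diff[OF iso_D(7)[OF gsD], symmetric] iso_D(6)[OF gsD])
    show "\<forall>\<^sub>F k in sequentially. norm (inv (gs (t (t' k))) (r (t (t' k)))) \<le> M"
      using M by (simp add: iso_D(6)[OF gsD])
  qed
  then show False using q_small norm_triangle_ineq[of "p - q" q] by simp
qed

lemma decomposition:
  "\<exists>g' r. (\<forall>n k. \<exists>k'. g' n k = g n k') \<and>
    (\<forall>m n. m \<noteq> n \<longrightarrow> w m \<noteq> 0 \<longrightarrow> w n \<noteq> 0 \<longrightarrow> op_weak_conv (\<lambda>k. inv (g' n k) \<circ> g' m k) (\<lambda>_. 0)) \<and>
    D_delta_null D r \<and>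
    (\<exists>S. unif_uncond_sum (\<lambda>j k. g' j k (w j)) S \<and> (\<forall>k. u k = S k + r k)) \<and>
    (\<forall>n. limsup (\<lambda>k. ereal (norm (r k))) \<le> ereal (\<rho> n))"
proof -
  obtain K S where S: "unif_uncond_sum (\<lambda>j k. g j (max k (K j)) (w j)) S"
    using rearranged_uncond_sum[of "\<lambda>j k. g j k (w j)", OF small_tails] by blast
  define g' where "g' j k = g j (max k (K j))" for j k
  define r where "r k = u k - S k" for k
  have S': "unif_uncond_sum (\<lambda>j k. g' j k (w j)) S" using S unfolding g'_def .
  have g'_eq: "\<forall>\<^sub>F k in sequentially. g' j k = g j k" for j
    using eventually_ge_at_top[of "K j"] by eventually_elim (simp add: g'_def)
  have approx: "\<exists>m. \<forall>n\<ge>m. \<forall>\<^sub>F k in sequentially. norm (r k - V n k) < e" if "e > 0" for e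
  proof -
    obtain F0 where F0: "finite F0"
      "\<And>F k. finite F \<Longrightarrow> F0 \<subseteq> F \<Longrightarrow> norm ((\<Sum>j\<in>F. g' j k (w j)) - S k) < e"
      using S'[unfolded unif_uncond_sum_def, THEN spec, of e] \<open>e > 0\<close> by auto
    obtain m where m: "F0 \<subseteq> {..<m}" using F0(1) finite_nat_iff_bounded by blast
    have "\<forall>\<^sub>F k in sequentially. norm (r k - V n k) < e" if "n \<ge> m" for n
    proof -
      have "\<forall>\<^sub>F k in sequentially. \<forall>j\<in>{..<n}. g' j k = g j k"
        using g'_eq by (intro eventually_ball_finite) auto
      then show ?thesis
      proof eventually_elim
        case (elim k)
        have "(\<Sum>j<n. g' j k (w j)) = (\<Sum>j<n. g j k (w j))" using elim by (intro sum.cong) auto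
        then have "r k - V n k = (\<Sum>j<n. g' j k (w j)) - S k" by (simp add: r_def V_eq)
        moreover have "F0 \<subseteq> {..<n}" using m that by auto
        ultimately show ?case using F0(2)[of "{..<n}" k] by simp
      qed
    qed
    then show ?thesis by blast
  qed
  have "bounded (range r)"
  proof -
    obtain F0 where F0: "finite F0" "\<And>k. norm ((\<Sum>j\<in>F0. g' j k (w j)) - S k) < 1"
      using S'[unfolded unif_uncond_sum_def, THEN spec, of 1] by auto
    obtain M where M: "\<And>k. norm (u k) \<le> M" using u unfolding bounded_iff by auto
    have "norm (r k) \<le> M + (1 + (\<Sum>j\<in>F0. norm (w j)))" for k
    proof -
      have "norm (r k) \<le> norm (u k) + norm (S k)" unfolding r_def by (rule norm_triangle_ineq4)
      moreover have "norm (S k) \<le> norm ((\<Sum>j\<in>F0. g' j k (w j)) - S k) + norm (\<Sum>j\<in>F0. g' j k (w j))"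
        using norm_triangle_ineq4[of "\<Sum>j\<in>F0. g' j k (w j)" "(\<Sum>j\<in>F0. g' j k (w j)) - S k"] by simp
      moreover have "norm (\<Sum>j\<in>F0. g' j k (w j)) \<le> (\<Sum>j\<in>F0. norm (w j))"
        using norm_sum[of "\<lambda>j. g' j k (w j)" F0] by (simp add: g'_def iso_g(3))
      ultimately show ?thesis using M[of k] F0(2)[of k] by linarith
    qed
    then show ?thesis unfolding bounded_iff by blast
  qed
  then have null: "D_delta_null D r" using approx by (rule D_delta_null_remainder)
  have dec: "op_weak_conv (\<lambda>k. inv (g' n k) \<circ> g' m k) (\<lambda>_. 0)"
    if "m \<noteq> n" "w m \<noteq> 0" "w n \<noteq> 0" for m n
    unfolding op_weak_conv_def weak_conv_def
  proof (intro allI impI)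
    fix y and f :: "'a \<Rightarrow> real" assume f: "bounded_linear f"
    have "(\<lambda>k. f ((inv (g n k) \<circ> g m k) y)) \<longlonglongrightarrow> f 0"
      using decoupled[of n m] that f unfolding op_weak_conv_def weak_conv_def by blast
    moreover have "\<forall>\<^sub>F k in sequentially. f ((inv (g n k) \<circ> g m k) y) = f ((inv (g' n k) \<circ> g' m k) y)"
      using g'_eq[of n] g'_eq[of m] by eventually_elim simp
    ultimately show "(\<lambda>k. f ((inv (g' n k) \<circ> g' m k) y)) \<longlonglongrightarrow> f 0"
      by (rule Lim_transform_eventually)
  qed
  have ls: "limsup (\<lambda>k. ereal (norm (r k))) \<le> ereal (\<rho> n)" for n
  proof (rule ereal_le_epsilon2)
    fix e :: real assume e: "e > 0"
    obtain m where "\<And>n. n \<ge> m \<Longrightarrow> \<forall>\<^sub>F k in sequentially. norm (r k - V n k) < e / 2"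
      using approx[of "e / 2"] e by auto
    then have "\<forall>\<^sub>F k in sequentially. norm (r k - V (max m n) k) < e / 2" by simp
    moreover have "\<forall>\<^sub>F k in sequentially. norm (V (max m n) k) < \<rho> (max m n) + e / 2"
      using order_tendstoD(2)[OF limit] e by simp
    ultimately have "\<forall>\<^sub>F k in sequentially. ereal (norm (r k)) \<le> ereal (\<rho> n + e)"
    proof eventually_elim
      case (elim k)
      then show ?case
        using norm_triangle_ineq[of "r k - V (max m n) k" "V (max m n) k"] limit_mono[of n "max m n"] by simp
    qed
    then show "limsup (\<lambda>k. ereal (norm (r k))) \<le> ereal (\<rho> n) + ereal e"
      by (simp add: Limsup_bounded)
  qed
  have orig: "\<exists>k'. g' n k = g n k'" for n k unfolding g'_def by blast
  have sum: "\<exists>S. unif_uncond_sum (\<lambda>j k. g' j k (w j)) S \<and> (\<forall>k. u k = S k + r k)"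
    using S' by (intro exI[of _ S]) (simp add: r_def)
  show ?thesis
    by (rule exI[of _ g'], rule exI[of _ r], intro conjI allI impI orig dec null sum ls)
qed

end

theorem theorem5p5:
  fixes D D0 :: "('a::banach \<Rightarrow> 'a) set" and x :: "nat \<Rightarrow> 'a"
  assumes "uniformly_convex TYPE('a)" and "uniformly_smooth TYPE('a)"
    and "dislocation_group D0" and "D \<subseteq> D0" and "id \<in> D"
    and "bounded (range x)"
  shows "has_delta_profile_decomp D x \<and>
    ((\<forall>k. norm (x k) \<le> 1) \<longrightarrow>
      (\<exists>s w g r. delta_profile_decomp D x s w g r \<and> (\<forall>n. norm (w n) \<le> 2) \<and>
         limsup (\<lambda>k. ereal (norm (r k)))
           + (\<Sum>n. ereal (modulus_convexity TYPE('a) (norm (w n)))) \<le> 1))"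
proof -
  have iso: "\<forall>h\<in>D. bij_linear_isometry h"
    using dislocation_groupD(1)[OF assms(3)] assms(4) by blast
  obtain s :: "nat \<Rightarrow> nat" and w g where s: "strict_mono s" and gD: "\<forall>n k. g n k \<in> D"
    and g0: "\<forall>k. g 0 k = id"
    and prof: "\<forall>n. delta_conv (\<lambda>k. inv (g n k) (x (s k) - (\<Sum>j<n. g j k (w j)))) (w n)"
    and conv: "\<forall>n. convergent (\<lambda>k. norm (x (s k) - (\<Sum>j<n. g j k (w j))))"
    and max: "\<forall>n (t :: nat \<Rightarrow> nat) h p. strict_mono t \<longrightarrow> range h \<subseteq> D \<longrightarrow>
      delta_conv (\<lambda>i. inv (h i) (x (s (t i)) - (\<Sum>j<Suc n. g j (t i) (w j)))) p \<longrightarrow>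
      norm p \<le> 2 * norm (w (Suc n))"
    using greedy_extraction[OF assms(1) iso assms(5,6)] by (elim exE conjE) (rule that; assumption)
  define \<rho> where "\<rho> n = lim (\<lambda>k. norm (x (s k) - (\<Sum>j<n. g j k (w j))))" for n
  interpret profile_extraction D0 D "\<lambda>k. x (s k)" g w \<rho> "\<lambda>n k. x (s k) - (\<Sum>j<n. g j k (w j))"
  proof
    show "bounded (range (\<lambda>k. x (s k)))" by (rule bounded_subset[OF assms(6)]) auto
    show "(\<lambda>k. norm (x (s k) - (\<Sum>j<n. g j k (w j)))) \<longlonglongrightarrow> \<rho> n" for n
      using spec[OF conv, of n] unfolding \<rho>_def convergent_LIMSEQ_iff .
  qed (fact assms gD[rule_format] prof[rule_format] refl max[rule_format])+
  obtain g' r where g'D: "\<forall>n k. \<exists>k'. g' n k = g n k'"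
    and dec: "\<forall>m n. m \<noteq> n \<longrightarrow> w m \<noteq> 0 \<longrightarrow> w n \<noteq> 0 \<longrightarrow> op_weak_conv (\<lambda>k. inv (g' n k) \<circ> g' m k) (\<lambda>_. 0)"
    and null: "D_delta_null D r"
    and S: "\<exists>S. unif_uncond_sum (\<lambda>j k. g' j k (w j)) S \<and> (\<forall>k. x (s k) = S k + r k)"
    and ls: "\<forall>n. limsup (\<lambda>k. ereal (norm (r k))) \<le> ereal (\<rho> n)"
    using decomposition by (elim exE, elim conjE) (rule that; assumption)
  have "\<forall>n k. g' n k \<in> D" "\<forall>k. g' 0 k = id"
    using g'D gD g0 by metis+
  then have decomp: "delta_profile_decomp D x s w g' r"
    unfolding delta_profile_decomp_def using s dec null S by (intro conjI)
  have "norm (w n) \<le> 2 \<and> limsup (\<lambda>k. ereal (norm (r k)))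
      + (\<Sum>n. ereal (modulus_convexity TYPE('a) (norm (w n)))) \<le> 1"
    if x1: "\<forall>k. norm (x k) \<le> 1" for n
  proof
    have "\<rho> 0 \<le> 1"
      using x1 by (intro tendsto_upperbound[OF limit[of 0]]) auto
    then have \<rho>1: "\<rho> m \<le> 1" for m using limit_mono[of 0 m] by simp
    show "norm (w n) \<le> 2" using norm_profile_le[of n] \<rho>1[of n] \<rho>1[of "Suc n"] by linarith
    \<comment> \<open>The energy steps telescope. Keeping \<open>\<rho> n\<close> on the right
      leaves room for the remainder, whose limsup is at most every \<open>\<rho> n\<close>.\<close>
    have "(\<Sum>j<n. modulus_convexity TYPE('a) (norm (w j))) \<le> 1 - \<rho> n" for n
    proof (induction n)
      case (Suc n)
      then show ?case using energy_step[of n] x1 by simp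
    qed (use \<open>\<rho> 0 \<le> 1\<close> in simp)
    note partial = this
    \<comment> \<open>The limsup lies between 0 and \<open>\<rho> 0\<close>, hence is a real number
      \<open>l\<close> and can be moved across the inequality between extended reals.\<close>
    have "0 \<le> limsup (\<lambda>k. ereal (norm (r k)))"
      by (rule le_Limsup) (auto intro: always_eventually)
    then obtain l where l: "limsup (\<lambda>k. ereal (norm (r k))) = ereal l"
      using spec[OF ls, of 0] by (cases "limsup (\<lambda>k. ereal (norm (r k)))") auto
    have "(\<Sum>n. ereal (modulus_convexity TYPE('a) (norm (w n)))) \<le> ereal (1 - l)"
    proof (rule suminf_bound)
      show "\<forall>n. (\<Sum>j<n. ereal (modulus_convexity TYPE('a) (norm (w j)))) \<le> ereal (1 - l)"
      proof
        fix n
        show "(\<Sum>j<n. ereal (modulus_convexity TYPE('a) (norm (w j)))) \<le> ereal (1 - l)"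
          using partial[of n] spec[OF ls, of n] l by simp
      qed
    qed (simp add: modulus_convexity_nonneg)
    then have "ereal l + (\<Sum>n. ereal (modulus_convexity TYPE('a) (norm (w n)))) \<le> ereal l + ereal (1 - l)"
      by (rule add_left_mono)
    then show "limsup (\<lambda>k. ereal (norm (r k)))
      + (\<Sum>n. ereal (modulus_convexity TYPE('a) (norm (w n)))) \<le> 1"
      unfolding l by (simp add: one_ereal_def)
  qed
  then show ?thesis unfolding has_delta_profile_decomp_def using decomp by blast
qed

end
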